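(* Let $\Gamma$ be the defining graph of an Artin group $A_\Gamma$, and let $T\subseteq V(\Gamma)$ be the set of cone points of $\Gamma$. Then $Z(A_\Gamma)\subseteq Z(A_T)$, where $A_T$ is the special subgroup of $A_\Gamma$ generated by $T$.
   Context: $Z(G)$ denotes the center of a group $G$. A defining graph is a finite simplicial graph $\Gamma$ with vertex set $V(\Gamma)=\{s_1,\dots,s_n\}$ in which each edge $(s_i,s_j)$ carries an integer label $m_{ij}=m_{ji}\ge 2$; if $s_i\ne s_j$ are not joined by an edge, one writes $m_{ij}=\infty$. The Artin group $A_\Gamma$ is the group with generators $V(\Gamma)$ and, for each edge $(s_i,s_j)$, the relation $s_is_js_i\cdots=s_js_is_j\cdots$ with $m_{ij}$ letters on each side (no relation is imposed when $m_{ij}=\infty$). For $K\subseteq V(\Gamma)$, the special subgroup $A_K$ is the subgroup of $A_\Gamma$ generated by $K$; by a theorem of van der Lek it is isomorphic (via the identity on generators) to the Artin group whose defining graph is the labelled subgraph $\Gamma_K$ induced by $K$. The special subgroup $A_\emptyset$ is trivial. A cone point of $\Gamma$ is a vertex that is adjacent to every other vertex of $\Gamma$ (the edge labels being arbitrary). The set of cone points may be empty. *)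

theory Defs
  imports "HOL-Algebra.Generated_Groups"
begin

section \<open>Groups given by generators and relations\<close>

text \<open>A letter \<open>(s, True)\<close> stands for the generator \<open>s\<close>, and \<open>(s, False)\<close> for its inverse.\<close>

type_synonym 'a word = "('a \<times> bool) list"

definition words :: "'a set \<Rightarrow> 'a word set" where
  "words S = lists (S \<times> UNIV)"

text \<open>
  The smallest congruence on the free monoid of words that makes the letters \<open>(s, True)\<close> and
  \<open>(s, False)\<close> mutually inverse and identifies the two sides of each relation in \<open>R\<close>.
\<close>

inductive_set pres_rel :: "'a set \<Rightarrow> ('a word \<times> 'a word) set \<Rightarrow> ('a word \<times> 'a word) set"
  for S :: "'a set" and R :: "('a word \<times> 'a word) set" where
  refl: "w \<in> words S \<Longrightarrow> (w, w) \<in> pres_rel S R"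
| sym: "(v, w) \<in> pres_rel S R \<Longrightarrow> (w, v) \<in> pres_rel S R"
| trans: "(u, v) \<in> pres_rel S R \<Longrightarrow> (v, w) \<in> pres_rel S R \<Longrightarrow> (u, w) \<in> pres_rel S R"
| cancel: "u \<in> words S \<Longrightarrow> v \<in> words S \<Longrightarrow> s \<in> S \<Longrightarrow>
    (u @ [(s, e), (s, \<not> e)] @ v, u @ v) \<in> pres_rel S R"
| relation: "(l, r) \<in> R \<Longrightarrow> l \<in> words S \<Longrightarrow> r \<in> words S \<Longrightarrow> u \<in> words S \<Longrightarrow> v \<in> words S \<Longrightarrow>
    (u @ l @ v, u @ r @ v) \<in> pres_rel S R"

definition presented_group :: "'a set \<Rightarrow> ('a word \<times> 'a word) set \<Rightarrow> 'a word set monoid" where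
  "presented_group S R =
    \<lparr>carrier = words S // pres_rel S R,
     mult = (\<lambda>A B. \<Union>a\<in>A. \<Union>b\<in>B. pres_rel S R `` {a @ b}),
     one = pres_rel S R `` {[]}\<rparr>"

lemma words_Nil [simp]: "[] \<in> words S"
  and words_Cons [simp]: "x # w \<in> words S \<longleftrightarrow> fst x \<in> S \<and> w \<in> words S"
  and words_append [simp]: "v @ w \<in> words S \<longleftrightarrow> v \<in> words S \<and> w \<in> words S"
  by (auto simp: words_def mem_Times_iff)

lemma pres_rel_words: "(v, w) \<in> pres_rel S R \<Longrightarrow> v \<in> words S \<and> w \<in> words S"
  by (induction rule: pres_rel.induct) auto

lemma equiv_pres_rel: "equiv (words S) (pres_rel S R)"
proof (rule equivI)
  show "pres_rel S R \<subseteq> words S \<times> words S" by (auto dest: pres_rel_words)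
  show "refl_on (words S) (pres_rel S R)" by (rule refl_onI) (rule pres_rel.refl)
  show "sym (pres_rel S R)" by (rule symI) (rule pres_rel.sym)
  show "trans (pres_rel S R)" by (rule transI) (rule pres_rel.trans)
qed

lemma pres_rel_append_left:
  "(v, w) \<in> pres_rel S R \<Longrightarrow> x \<in> words S \<Longrightarrow> (x @ v, x @ w) \<in> pres_rel S R"
proof (induction rule: pres_rel.induct)
  case (refl w) then show ?case by (auto intro: pres_rel.refl)
next
  case sym then show ?case by (simp add: pres_rel.sym)
next
  case trans then show ?case by (blast intro: pres_rel.trans)
next
  case (cancel u v s e)
  then show ?case using pres_rel.cancel[of "x @ u" S v s e R] by simp
next
  case (relation l r u v)
  then show ?case using pres_rel.relation[of l r R S "x @ u" v] by simp
qed

lemma pres_rel_append_right: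
  "(v, w) \<in> pres_rel S R \<Longrightarrow> x \<in> words S \<Longrightarrow> (v @ x, w @ x) \<in> pres_rel S R"
proof (induction rule: pres_rel.induct)
  case (refl w) then show ?case by (auto intro: pres_rel.refl)
next
  case sym then show ?case by (simp add: pres_rel.sym)
next
  case trans then show ?case by (blast intro: pres_rel.trans)
next
  case (cancel u v s e)
  then show ?case using pres_rel.cancel[of u S "v @ x" s e R] by simp
next
  case (relation l r u v)
  then show ?case using pres_rel.relation[of l r R S u "v @ x"] by simp
qed

lemma pres_rel_append:
  assumes "(v, v') \<in> pres_rel S R" "(w, w') \<in> pres_rel S R"
  shows "(v @ w, v' @ w') \<in> pres_rel S R"
proof (rule pres_rel.trans)
  show "(v @ w, v' @ w) \<in> pres_rel S R"
    using assms pres_rel_words by (blast intro: pres_rel_append_right)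
  show "(v' @ w, v' @ w') \<in> pres_rel S R"
    using assms pres_rel_words by (blast intro: pres_rel_append_left)
qed

lemma presented_group_mult:
  assumes "v \<in> words S" "w \<in> words S"
  shows "(pres_rel S R `` {v}) \<otimes>\<^bsub>presented_group S R\<^esub> (pres_rel S R `` {w})
           = pres_rel S R `` {v @ w}"
proof -
  let ?A = "pres_rel S R `` {v}" and ?B = "pres_rel S R `` {w}"
  have "pres_rel S R `` {a @ b} = pres_rel S R `` {v @ w}" if "a \<in> ?A" "b \<in> ?B" for a b
    using equiv_class_eq[OF equiv_pres_rel pres_rel_append] that by (metis Image_singleton_iff)
  then have "(\<Union>a\<in>?A. \<Union>b\<in>?B. pres_rel S R `` {a @ b}) = (\<Union>a\<in>?A. \<Union>b\<in>?B. pres_rel S R `` {v @ w})"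
    by (intro SUP_cong HOL.refl) simp
  moreover have "v \<in> ?A" "w \<in> ?B"
    using assms by (simp_all add: pres_rel.refl)
  then have "?A \<noteq> {}" "?B \<noteq> {}"
    by blast+
  ultimately show ?thesis
    unfolding presented_group_def by simp
qed

definition inv_word :: "'a word \<Rightarrow> 'a word" where
  "inv_word w = rev (map (\<lambda>(s, e). (s, \<not> e)) w)"

lemma inv_word_words [simp]: "inv_word w \<in> words S \<longleftrightarrow> w \<in> words S"
  by (induction w) (auto simp: inv_word_def)

lemma inv_word_cancel:
  "w \<in> words S \<Longrightarrow> (inv_word w @ w, []) \<in> pres_rel S R"
proof (induction w)
  case Nil then show ?case by (auto simp: inv_word_def intro: pres_rel.refl)
next
  case (Cons x w)
  obtain s e where x: "x = (s, e)" by (cases x)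
  have "(inv_word w @ [(s, \<not> e), (s, \<not> \<not> e)] @ w, inv_word w @ w) \<in> pres_rel S R"
    using Cons.prems x by (intro pres_rel.cancel) auto
  moreover have "(inv_word w @ w, []) \<in> pres_rel S R" using Cons by simp
  ultimately show ?case
    by (simp add: inv_word_def x) (rule pres_rel.trans)
qed

lemma group_presented_group: "group (presented_group S R)"
proof (rule groupI)
  let ?G = "presented_group S R"
  have carr: "carrier ?G = (\<lambda>w. pres_rel S R `` {w}) ` words S"
    by (auto simp: presented_group_def quotient_def)
  have one: "\<one>\<^bsub>?G\<^esub> = pres_rel S R `` {[]}"
    by (simp add: presented_group_def)
  show "\<one>\<^bsub>?G\<^esub> \<in> carrier ?G" by (auto simp: carr one)
  fix x assume "x \<in> carrier ?G"
  then obtain u where u: "u \<in> words S" "x = pres_rel S R `` {u}" by (auto simp: carr)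
  show "\<one>\<^bsub>?G\<^esub> \<otimes>\<^bsub>?G\<^esub> x = x"
    using u by (simp add: one presented_group_mult)
  have "pres_rel S R `` {inv_word u} \<otimes>\<^bsub>?G\<^esub> x = \<one>\<^bsub>?G\<^esub>"
    using u equiv_class_eq[OF equiv_pres_rel inv_word_cancel[of u S R]]
    by (simp add: one presented_group_mult)
  then show "\<exists>y\<in>carrier ?G. y \<otimes>\<^bsub>?G\<^esub> x = \<one>\<^bsub>?G\<^esub>"
    using u by (force simp: carr)
  fix y assume "y \<in> carrier ?G"
  then obtain v where v: "v \<in> words S" "y = pres_rel S R `` {v}" by (auto simp: carr)
  show "x \<otimes>\<^bsub>?G\<^esub> y \<in> carrier ?G"
    using u v by (auto simp: carr presented_group_mult)
  fix z assume "z \<in> carrier ?G"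
  then obtain w where w: "w \<in> words S" "z = pres_rel S R `` {w}" by (auto simp: carr)
  show "x \<otimes>\<^bsub>?G\<^esub> y \<otimes>\<^bsub>?G\<^esub> z = x \<otimes>\<^bsub>?G\<^esub> (y \<otimes>\<^bsub>?G\<^esub> z)"
    using u v w by (simp add: presented_group_mult)
qed


section \<open>Artin groups\<close>

text \<open>
  Edges are two-element sets of vertices, so the symmetry of the labels is built in. Only the
  values of \<open>label\<close> on \<open>edges\<close> matter; the label infinity is the absence of an edge.
\<close>

record 'v labelled_graph =
  verts :: "'v set"
  edges :: "'v set set"
  label :: "'v set \<Rightarrow> nat"

definition defining_graph :: "'v labelled_graph \<Rightarrow> bool" where
  "defining_graph \<Gamma> \<longleftrightarrow>
     finite (verts \<Gamma>) \<and>
     (\<forall>e\<in>edges \<Gamma>. e \<subseteq> verts \<Gamma> \<and> card e = 2) \<and>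
     (\<forall>e\<in>edges \<Gamma>. label \<Gamma> e \<ge> 2)"

definition cone_points :: "'v labelled_graph \<Rightarrow> 'v set" where
  "cone_points \<Gamma> = {s \<in> verts \<Gamma>. \<forall>t\<in>verts \<Gamma>. t \<noteq> s \<longrightarrow> {s, t} \<in> edges \<Gamma>}"

primrec alternating_word :: "nat \<Rightarrow> 'v \<Rightarrow> 'v \<Rightarrow> 'v word" where
  "alternating_word 0 s t = []"
| "alternating_word (Suc n) s t = (s, True) # alternating_word n t s"

definition artin_relations :: "'v labelled_graph \<Rightarrow> ('v word \<times> 'v word) set" where
  "artin_relations \<Gamma> =
     {(alternating_word (label \<Gamma> {s, t}) s t, alternating_word (label \<Gamma> {s, t}) t s) | s t.
        {s, t} \<in> edges \<Gamma>}"

definition artin_group :: "'v labelled_graph \<Rightarrow> 'v word set monoid" where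
  "artin_group \<Gamma> = presented_group (verts \<Gamma>) (artin_relations \<Gamma>)"

definition artin_generator :: "'v labelled_graph \<Rightarrow> 'v \<Rightarrow> 'v word set" where
  "artin_generator \<Gamma> s = pres_rel (verts \<Gamma>) (artin_relations \<Gamma>) `` {[(s, True)]}"

definition special_subgroup :: "'v labelled_graph \<Rightarrow> 'v set \<Rightarrow> 'v word set set" where
  "special_subgroup \<Gamma> K = generate (artin_group \<Gamma>) (artin_generator \<Gamma> ` K)"

definition center :: "('a, 'b) monoid_scheme \<Rightarrow> 'a set" where
  "center G = {z \<in> carrier G. \<forall>g\<in>carrier G. z \<otimes>\<^bsub>G\<^esub> g = g \<otimes>\<^bsub>G\<^esub> z}"

lemma group_artin_group: "group (artin_group \<Gamma>)"
  by (simp add: artin_group_def group_presented_group)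

lemma artin_generator_closed: "s \<in> verts \<Gamma> \<Longrightarrow> artin_generator \<Gamma> s \<in> carrier (artin_group \<Gamma>)"
  by (auto simp: artin_generator_def artin_group_def presented_group_def intro: quotientI)

lemma subgroup_special_subgroup:
  "K \<subseteq> verts \<Gamma> \<Longrightarrow> subgroup (special_subgroup \<Gamma> K) (artin_group \<Gamma>)"
  unfolding special_subgroup_def
  by (intro group.generate_is_subgroup group_artin_group) (auto intro: artin_generator_closed)

end

theory Submission
  imports Defs Complex_Main
begin

text \<open>
  If \<open>s\<close> and \<open>t\<close> are not adjacent, then \<open>A\<^sub>\<Gamma>\<close> is the amalgamated product of its special subgroups
  \<open>P = A\<^bsub>V - {s}\<^esub>\<close> and \<open>Q = A\<^bsub>V - {t}\<^esub>\<close> over \<open>P \<inter> Q\<close>. A central element \<open>z\<close> fixes the edge \<open>P \<inter> Q\<close>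
  of the Bass--Serre tree: otherwise the path from this edge to its image under \<open>z\<close> could be
  continued to the images under \<open>z h = h z\<close> for \<open>h\<close> in either \<open>P - Q\<close> or \<open>Q - P\<close>, without
  backtracking, whereas applying \<open>h\<close> to the path leads to a different reduced path with the same
  ends. Hence \<open>z \<in> A\<^bsub>V - {s}\<^esub>\<close> for every vertex \<open>s\<close> that is not a cone point, and it remains to see
  that \<open>A\<^sub>X \<inter> A\<^sub>Y = A\<^bsub>X \<inter> Y\<^esub>\<close>. This theorem of van der Lek follows from the retraction of
  \<open>A\<^sub>\<Gamma>\<close> onto \<open>A\<^sub>X\<close> (a map of sets) due to Godelle and Paris, which maps \<open>A\<^sub>Y\<close> to \<open>A\<^bsub>X \<inter> Y\<^esub>\<close>. It is
  constructed from the root system of the Coxeter group, and it respects the braid relations because every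
  root is positive or negative.
\<close>

section \<open>The reflection representation\<close>

locale artin_graph =
  fixes \<Gamma> :: "'v labelled_graph"
  assumes graph: "defining_graph \<Gamma>"
begin

abbreviation V :: "'v set" where "V \<equiv> verts \<Gamma>"

abbreviation rel :: "('v word \<times> 'v word) set" where "rel \<equiv> pres_rel V (artin_relations \<Gamma>)"

lemma finite_verts [simp]: "finite V"
  using graph by (simp add: defining_graph_def)

lemma edgeD:
  assumes "{s, t} \<in> edges \<Gamma>"
  shows "s \<in> V" "t \<in> V" "s \<noteq> t" "2 \<le> label \<Gamma> {s, t}"
  using assms graph by (auto simp: defining_graph_def)

text \<open>Twice the Tits form on simple roots. A non-adjacent pair gets -2, the limit of -2 cos
  (pi / m) as m tends to infinity.\<close>

definition cartan :: "'v \<Rightarrow> 'v \<Rightarrow> real" where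
  "cartan s t =
     (if s = t then 2 else if {s, t} \<in> edges \<Gamma> then - 2 * cos (pi / label \<Gamma> {s, t}) else - 2)"

text \<open>Vectors are functions on the whole type: coordinates outside \<open>V\<close> do not
  enter the form, and reflections in vertices leave them alone.\<close>

definition pairing :: "('v \<Rightarrow> real) \<Rightarrow> 'v \<Rightarrow> real" where
  "pairing v s = (\<Sum>r\<in>V. cartan s r * v r)"

definition simple_root :: "'v \<Rightarrow> 'v \<Rightarrow> real" where
  "simple_root s r = (if r = s then 1 else 0)"

definition reflect :: "'v \<Rightarrow> ('v \<Rightarrow> real) \<Rightarrow> 'v \<Rightarrow> real" where
  "reflect s v = (\<lambda>r. v r - pairing v s * simple_root s r)"

definition form :: "('v \<Rightarrow> real) \<Rightarrow> ('v \<Rightarrow> real) \<Rightarrow> real" where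
  "form u v = (\<Sum>r\<in>V. u r * pairing v r)"

abbreviation act :: "'v list \<Rightarrow> ('v \<Rightarrow> real) \<Rightarrow> 'v \<Rightarrow> real" where
  "act w \<equiv> foldr reflect w"

definition comb :: "real \<Rightarrow> ('v \<Rightarrow> real) \<Rightarrow> real \<Rightarrow> ('v \<Rightarrow> real) \<Rightarrow> 'v \<Rightarrow> real" where
  "comb a u b v = (\<lambda>r. a * u r + b * v r)"

lemma cartan_sym: "cartan s t = cartan t s"
  by (simp add: cartan_def insert_commute)

lemma cartan_same [simp]: "cartan s s = 2"
  by (simp add: cartan_def)

lemma pairing_comb: "pairing (comb a u b v) s = a * pairing u s + b * pairing v s"
  by (simp add: pairing_def comb_def sum_distrib_left sum.distrib algebra_simps)

lemma reflect_comb: "reflect s (comb a u b v) = comb a (reflect s u) b (reflect s v)"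
  by (simp add: reflect_def pairing_comb fun_eq_iff) (simp add: comb_def algebra_simps)

lemma act_comb: "act w (comb a u b v) = comb a (act w u) b (act w v)"
  by (induction w) (simp_all add: reflect_comb)

lemma act_scale: "act w (\<lambda>r. a * u r) = (\<lambda>r. a * act w u r)"
  using act_comb[of w a u 0 u] by (simp add: comb_def)

lemma act_uminus: "act w (\<lambda>r. - u r) = (\<lambda>r. - act w u r)"
  using act_scale[of w "-1" u] by simp

lemma pairing_simple_root: "t \<in> V \<Longrightarrow> pairing (simple_root t) s = cartan s t"
  by (simp add: pairing_def simple_root_def if_distrib cong: if_cong)

lemma form_comb_left: "form (comb a u b v) w = a * form u w + b * form v w"
  by (simp add: form_def comb_def sum_distrib_left sum.distrib algebra_simps)

lemma form_sym: "form u v = form v u"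
proof -
  have "form u v = (\<Sum>r\<in>V. \<Sum>t\<in>V. cartan r t * u r * v t)"
    by (simp add: form_def pairing_def sum_distrib_left mult_ac)
  also have "\<dots> = (\<Sum>t\<in>V. \<Sum>r\<in>V. cartan r t * u r * v t)"
    by (rule sum.swap)
  also have "\<dots> = form v u"
    by (simp add: form_def pairing_def sum_distrib_left mult_ac cartan_sym)
  finally show ?thesis .
qed

lemma form_simple_root: "s \<in> V \<Longrightarrow> form (simple_root s) v = pairing v s"
  by (simp add: form_def simple_root_def if_distrib[of "\<lambda>x. x * _"] cong: if_cong)

lemma form_simple_root_right: "s \<in> V \<Longrightarrow> form v (simple_root s) = pairing v s"
  using form_simple_root[of s v] by (simp add: form_sym[of v])

lemma form_comb_right: "form w (comb a u b v) = a * form w u + b * form w v"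
  by (simp add: form_sym[of w] form_comb_left)

lemma reflect_eq_comb: "reflect s v = comb 1 v (- pairing v s) (simple_root s)"
  by (simp add: reflect_def comb_def)

lemma form_reflect:
  assumes "s \<in> V"
  shows "form (reflect s u) (reflect s v) = form u v"
  using assms
  by (simp add: reflect_eq_comb form_comb_left form_comb_right form_simple_root
      form_simple_root_right pairing_simple_root pairing_comb algebra_simps)

lemma form_act: "set w \<subseteq> V \<Longrightarrow> form (act w u) (act w v) = form u v"
  by (induction w) (simp_all add: form_reflect)

lemma pairing_reflect_self: "s \<in> V \<Longrightarrow> pairing (reflect s v) s = - pairing v s"
  by (simp add: reflect_eq_comb pairing_comb pairing_simple_root)

lemma reflect_reflect: "s \<in> V \<Longrightarrow> reflect s (reflect s v) = v"
  by (rule ext, subst reflect_def) (simp add: pairing_reflect_self, simp add: reflect_def)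

lemma reflect_simple_root_self: "s \<in> V \<Longrightarrow> reflect s (simple_root s) = (\<lambda>r. - simple_root s r)"
  by (simp add: reflect_def pairing_simple_root)

lemma act_rev_act: "set w \<subseteq> V \<Longrightarrow> act (rev w) (act w v) = v"
  by (induction w arbitrary: v) (simp_all add: reflect_reflect)

lemma act_act_rev: "set w \<subseteq> V \<Longrightarrow> act w (act (rev w) v) = v"
  using act_rev_act[of "rev w" v] by simp

lemma act_inject: "set w \<subseteq> V \<Longrightarrow> act w u = act w v \<longleftrightarrow> u = v"
  by (metis act_rev_act)

lemma simple_root_inject [simp]: "simple_root s = simple_root t \<longleftrightarrow> s = t"
  by (auto simp: simple_root_def fun_eq_iff split: if_splits)

lemma act_simple_root_outside: "t \<notin> set w \<Longrightarrow> act w v t = v t"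
  by (induction w) (auto simp: reflect_def simple_root_def)

text \<open>The classical identity that conjugating a reflection by w gives the reflection in the
  image root. Invariance of the form turns the pairing with \<open>s\<close> after
  \<open>act w\<close> into the pairing with \<open>x\<close> before it.\<close>

lemma act_conjugate:
  assumes "set w \<subseteq> V" "s \<in> V" "x \<in> V" "act w (simple_root x) = simple_root s"
  shows "reflect s (act w v) = act w (reflect x v)"
proof -
  have "pairing (act w v) s = form (act w (simple_root x)) (act w v)"
    using assms by (simp add: form_simple_root)
  also have "\<dots> = pairing v x"
    using assms(3) by (simp add: form_act[OF assms(1)] form_simple_root )
  finally show ?thesis
    by (simp add: reflect_eq_comb[of s] reflect_eq_comb[of x] act_comb assms)
qed

text \<open>All roots have the same norm 2 under the invariant form, so a nonnegative factor between
  two of them is 1.\<close>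

lemma act_simple_root_scaled:
  assumes "set w \<subseteq> V" "s \<in> V" "x \<in> V" "act w (simple_root x) = (\<lambda>r. a * simple_root s r)" "0 \<le> a"
  shows "a = 1"
proof -
  have "2 = form (act w (simple_root x)) (act w (simple_root x))"
    using assms(3) by (simp add: form_act[OF assms(1)] form_simple_root pairing_simple_root)
  also have "\<dots> = form (comb a (simple_root s) 0 (simple_root s)) (comb a (simple_root s) 0 (simple_root s))"
    by (simp add: assms comb_def)
  also have "\<dots> = 2 * a\<^sup>2"
    using assms(2)
    by (simp add: form_comb_left form_comb_right form_simple_root pairing_simple_root power2_eq_square)
  finally show ?thesis
    using \<open>0 \<le> a\<close> by (simp add: power2_eq_1_iff)
qed


section \<open>Dihedral subgroups and the braid relations\<close>

fun dihedral_coeff :: "real \<Rightarrow> nat \<Rightarrow> real" where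
  "dihedral_coeff c 0 = 0"
| "dihedral_coeff c (Suc 0) = 1"
| "dihedral_coeff c (Suc (Suc n)) = c * dihedral_coeff c (Suc n) - dihedral_coeff c n"

text \<open>\<open>dihedral_coeff c n\<close> is the Chebyshev polynomial of the second kind of
  degree n - 1 at c / 2; its recursion is the formula for sin (y + x) + sin (y - x).\<close>

lemma dihedral_coeff_sin: "sin x \<noteq> 0 \<Longrightarrow> dihedral_coeff (2 * cos x) n = sin (n * x) / sin x"
proof (induction "2 * cos x" n rule: dihedral_coeff.induct)
  case (3 n)
  define y where "y = Suc n * x"
  have "sin (Suc (Suc n) * x) = sin (y + x)" "sin (n * x) = sin (y - x)"
    by (simp_all add: y_def algebra_simps)
  then have "sin (Suc (Suc n) * x) = 2 * cos x * sin y - sin (n * x)"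
    by (simp add: sin_add sin_diff)
  moreover have "dihedral_coeff (2 * cos x) n = sin (n * x) / sin x"
    "dihedral_coeff (2 * cos x) (Suc n) = sin y / sin x"
    using 3 unfolding y_def by blast+
  ultimately show ?case
    by (simp only: dihedral_coeff.simps) (simp add: diff_divide_distrib)
qed auto

lemma dihedral_coeff_2: "dihedral_coeff 2 n = n"
  by (induction "2 :: real" n rule: dihedral_coeff.induct) auto

primrec alternating :: "nat \<Rightarrow> 'v \<Rightarrow> 'v \<Rightarrow> 'v list" where
  "alternating 0 s t = []"
| "alternating (Suc n) s t = s # alternating n t s"

lemma alternating_Suc_right:
  "alternating (Suc n) s t = alternating n s t @ [if even n then s else t]"
  by (induction n arbitrary: s t) auto

lemma set_alternating: "set (alternating n s t) \<subseteq> {s, t}"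
  by (induction n arbitrary: s t) auto

lemma length_alternating [simp]: "length (alternating n s t) = n"
  by (induction n arbitrary: s t) auto

lemma alternating_word_eq: "alternating_word n s t = map (\<lambda>s. (s, True)) (alternating n s t)"
  by (induction n arbitrary: s t) auto

text \<open>The root is that of the letter which would prolong the word on the right. Each further
  reflection on the left performs one step of the recursion of
  \<open>dihedral_coeff\<close>.\<close>

lemma act_alternating:
  assumes "s \<in> V" "t \<in> V"
  shows "act (alternating n s t) (simple_root (if even n then s else t)) =
    comb (dihedral_coeff (- cartan s t) (Suc n)) (simple_root s)
         (dihedral_coeff (- cartan s t) n) (simple_root t)"
  using assms
proof (induction n arbitrary: s t)
  case 0
  then show ?case by (simp add: comb_def)
next
  case (Suc n)
  have "act (alternating (Suc n) s t) (simple_root (if even (Suc n) then s else t)) =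
    reflect s (act (alternating n t s) (simple_root (if even n then t else s)))"
    by simp
  also have "\<dots> = reflect s (comb (dihedral_coeff (- cartan s t) (Suc n)) (simple_root t)
         (dihedral_coeff (- cartan s t) n) (simple_root s))"
    by (subst Suc.IH) (use Suc.prems in \<open>simp_all add: cartan_sym\<close>)
  also have "\<dots> = comb (dihedral_coeff (- cartan s t) (Suc (Suc n))) (simple_root s)
         (dihedral_coeff (- cartan s t) (Suc n)) (simple_root t)"
    using Suc.prems
    by (simp add: reflect_def pairing_comb pairing_simple_root fun_eq_iff) (simp add: comb_def algebra_simps)
  finally show ?case .
qed

lemma act_alternating_last:
  assumes "s \<in> V" "t \<in> V"
  shows "act (alternating (Suc n) s t) (simple_root (if even n then s else t)) =
    (\<lambda>r. - act (alternating n s t) (simple_root (if even n then s else t)) r)"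
  using assms by (subst alternating_Suc_right) (simp add: reflect_simple_root_self act_uminus)

text \<open>For x = pi / m the coefficients are sin (n x) / sin x, so the claims reduce to values
  and signs of sine at multiples of pi / m.\<close>

lemma
  assumes "{s, t} \<in> edges \<Gamma>"
  shows dihedral_coeff_label: "dihedral_coeff (- cartan s t) (label \<Gamma> {s, t}) = 0" (is ?a)
    and dihedral_coeff_Suc_label: "dihedral_coeff (- cartan s t) (Suc (label \<Gamma> {s, t})) = - 1" (is ?b)
    and dihedral_coeff_label_minus_1: "dihedral_coeff (- cartan s t) (label \<Gamma> {s, t} - 1) = 1" (is ?c)
    and dihedral_coeff_less_label: "\<And>n. 0 < n \<Longrightarrow> n < label \<Gamma> {s, t} \<Longrightarrow> 0 < dihedral_coeff (- cartan s t) n"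
    and cartan_edge_greater: "- 2 < cartan s t" and cartan_edge_le: "cartan s t \<le> 0"
proof -
  define m where "m = label \<Gamma> {s, t}"
  define x where "x = pi / m"
  have m: "2 \<le> m" using edgeD(4)[OF assms] by (simp add: m_def)
  have c: "- cartan s t = 2 * cos x"
    using assms edgeD(3)[OF assms] by (simp add: cartan_def x_def m_def)
  have x: "0 < x" "x \<le> pi / 2" using m divide_left_mono[of 2 "real m" pi] by (simp_all add: x_def)
  have sin: "0 < sin x" using x pi_gt_zero by (intro sin_gt_zero) linarith+
  have U: "dihedral_coeff (- cartan s t) n = sin (n * x) / sin x" for n
    unfolding c using sin by (intro dihedral_coeff_sin) auto
  have mx: "m * x = pi" using m by (simp add: x_def)
  show ?a by (simp add: U mx flip: m_def)
  have "Suc m * x = x + pi" using mx by (simp add: algebra_simps)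
  then show ?b using sin by (simp only: U flip: m_def) simp
  have "real (m - 1) * x = pi - x" using mx m by (simp add: of_nat_diff algebra_simps)
  then show ?c using sin by (simp only: U flip: m_def) simp
  show "0 < dihedral_coeff (- cartan s t) n" if "0 < n" "n < label \<Gamma> {s, t}" for n
  proof -
    have "n * x < m * x" using that x by (simp add: m_def)
    then have "0 < sin (n * x)" using that x mx by (intro sin_gt_zero) auto
    then show ?thesis using sin by (simp add: U)
  qed
  have "cos x < cos 0" using x by (intro cos_monotone_0_pi) auto
  then show "- 2 < cartan s t" using c by simp
  have "0 \<le> cos x" using x by (intro cos_ge_zero) auto
  then show "cartan s t \<le> 0" using c by simp
qed

lemma dihedral_coeff_nonneg:
  assumes "s \<noteq> t" "{s, t} \<in> edges \<Gamma> \<Longrightarrow> n \<le> label \<Gamma> {s, t}"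
  shows "0 \<le> dihedral_coeff (- cartan s t) n"
proof (cases "{s, t} \<in> edges \<Gamma>")
  case True
  then show ?thesis
    using assms(2) dihedral_coeff_label[OF True] dihedral_coeff_less_label[OF True, of n]
    by (cases "n = 0"; cases "n = label \<Gamma> {s, t}") auto
next
  case False
  then show ?thesis using assms by (simp add: cartan_def dihedral_coeff_2)
qed

text \<open>The chosen letter prolongs the first word and ends the second one. Both words send its
  root to the negative of the root of \<open>s\<close>.\<close>

lemma act_braid_simple_root:
  assumes "{s, t} \<in> edges \<Gamma>"
  defines "m \<equiv> label \<Gamma> {s, t}"
  shows "act (alternating m s t) (simple_root (if even m then s else t)) =
         act (alternating m t s) (simple_root (if even m then s else t))"
proof -
  note e = edgeD[OF assms(1)]
  obtain n where n: "m = Suc n" using e(4) by (cases m) (auto simp: m_def)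
  have "act (alternating m s t) (simple_root (if even m then s else t)) = (\<lambda>r. - simple_root s r)"
    using e by (subst act_alternating)
      (simp_all add: comb_def m_def dihedral_coeff_label[OF assms(1)] dihedral_coeff_Suc_label[OF assms(1)])
  moreover have "act (alternating m t s) (simple_root (if even m then s else t)) =
     (\<lambda>r. - act (alternating n t s) (simple_root (if even n then t else s)) r)"
    unfolding n using act_alternating_last[OF e(2,1), of n] by (cases "even n") simp_all
  moreover have "act (alternating n t s) (simple_root (if even n then t else s)) = simple_root s"
    using e dihedral_coeff_label[OF assms(1)] dihedral_coeff_label_minus_1[OF assms(1)] n
    by (subst act_alternating) (simp_all add: comb_def m_def cartan_sym)
  ultimately show ?thesis by simp
qed

text \<open>The form is nondegenerate on the plane of the two simple roots, so \<open>v\<close>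
  splits into a part in this plane and a part \<open>u\<close> orthogonal to it. Both words fix
  \<open>u\<close>, and they agree on the two simple roots.\<close>

lemma act_braid:
  assumes "{s, t} \<in> edges \<Gamma>"
  defines "m \<equiv> label \<Gamma> {s, t}"
  shows "act (alternating m s t) = act (alternating m t s)"
proof
  fix v
  note e = edgeD[OF assms(1)]
  define c where "c = cartan s t"
  have c: "c\<^sup>2 < 4"
    using cartan_edge_greater[OF assms(1)] cartan_edge_le[OF assms(1)]
    using abs_le_square_iff[of 2 c] by (simp add: c_def)
  \<comment> \<open>Cramer's rule for the orthogonality of \<open>u\<close> to both simple roots; 4
    - c^2 is the Gram determinant.\<close>
  define a where "a = (2 * pairing v s - c * pairing v t) / (4 - c\<^sup>2)"
  define b where "b = (2 * pairing v t - c * pairing v s) / (4 - c\<^sup>2)"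
  define u where "u = comb 1 v (- 1) (comb a (simple_root s) b (simple_root t))"
  have ab: "2 * a + c * b = pairing v s" "c * a + 2 * b = pairing v t"
  proof -
    have d: "4 - c\<^sup>2 \<noteq> 0" using c by simp
    have a: "(4 - c\<^sup>2) * a = 2 * pairing v s - c * pairing v t"
      and b: "(4 - c\<^sup>2) * b = 2 * pairing v t - c * pairing v s"
      using d by (simp_all add: a_def b_def)
    have "(4 - c\<^sup>2) * (2 * a + c * b) = 2 * ((4 - c\<^sup>2) * a) + c * ((4 - c\<^sup>2) * b)"
      "(4 - c\<^sup>2) * (c * a + 2 * b) = c * ((4 - c\<^sup>2) * a) + 2 * ((4 - c\<^sup>2) * b)"
      by (simp_all add: algebra_simps)
    then have "(4 - c\<^sup>2) * (2 * a + c * b) = (4 - c\<^sup>2) * pairing v s"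
      "(4 - c\<^sup>2) * (c * a + 2 * b) = (4 - c\<^sup>2) * pairing v t"
      unfolding a b by (simp_all add: algebra_simps power2_eq_square)
    then show "2 * a + c * b = pairing v s" "c * a + 2 * b = pairing v t"
      using d by (meson mult_left_cancel)+
  qed
  have u0: "pairing u s = 0" "pairing u t = 0"
    using e ab by (simp_all add: u_def pairing_comb pairing_simple_root cartan_sym[of t s] algebra_simps flip: c_def)
  have v: "v = comb 1 u 1 (comb a (simple_root s) b (simple_root t))"
    by (simp add: u_def comb_def)
  have fix_u: "act w u = u" if "set w \<subseteq> {s, t}" for w
    using that by (induction w) (auto simp: reflect_def u0)
  have "act (alternating m s t) (simple_root r) = act (alternating m t s) (simple_root r)" if "r \<in> {s, t}" for r
    using that act_braid_simple_root[OF assms(1)] act_braid_simple_root[of t s] assms(1) e(3)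
    by (auto simp: m_def insert_commute split: if_splits)
  moreover have "act (alternating m s t) u = u" "act (alternating m t s) u = u"
    using set_alternating[of m s t] set_alternating[of m t s] by (auto intro!: fix_u)
  ultimately show "act (alternating m s t) v = act (alternating m t s) v"
    by (subst (1 2) v) (simp add: act_comb)
qed


section \<open>Positive and negative roots\<close>

definition len :: "(('v \<Rightarrow> real) \<Rightarrow> 'v \<Rightarrow> real) \<Rightarrow> nat" where
  "len g = (LEAST n. \<exists>w. set w \<subseteq> V \<and> act w = g \<and> length w = n)"

lemma len_le: "set w \<subseteq> V \<Longrightarrow> len (act w) \<le> length w"
  unfolding len_def by (rule Least_le) blast

lemma len_attained:
  assumes "set w \<subseteq> V"
  obtains u where "set u \<subseteq> V" "act u = act w" "length u = len (act w)"
proof -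
  have "\<exists>u. set u \<subseteq> V \<and> act u = act w \<and> length u = len (act w)"
    unfolding len_def by (rule LeastI[where k = "length w"]) (use assms in blast)
  then show ?thesis using that by blast
qed

lemma act_append_self: "r \<in> V \<Longrightarrow> act (w @ [r, r]) = act w"
  by (rule ext) (simp add: reflect_reflect)

lemma act_append_cong: "act u = act u' \<Longrightarrow> act v = act v' \<Longrightarrow> act (u @ v) = act (u' @ v')"
  by (rule ext) simp

lemma alternating_add:
  "alternating (j + k) a b = alternating j a b @ (if even j then alternating k a b else alternating k b a)"
  by (induction j arbitrary: a b) auto

text \<open>Cancelling equal neighbours makes a word in two involutions alternate. The resulting
  length may still exceed the label.\<close>

lemma act_eq_alternating:
  assumes "set x \<subseteq> {s, t}" "s \<in> V" "t \<in> V"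
  shows "\<exists>n a b. {a, b} = {s, t} \<and> n \<le> length x \<and> act (alternating n a b) = act x"
  using assms
proof (induction x)
  case Nil
  then show ?case by (intro exI[of _ 0] exI[of _ s] exI[of _ t]) simp
next
  case (Cons r x)
  have "\<exists>n a b. {a, b} = {s, t} \<and> n \<le> length x \<and> act (alternating n a b) = act x"
    using Cons.prems by (intro Cons.IH) simp_all
  then obtain n a b where n: "{a, b} = {s, t}" "n \<le> length x" "act (alternating n a b) = act x"
    by (elim exE conjE)
  have "r = b \<or> r = a"
    using n(1) Cons.prems(1) by (auto simp: doubleton_eq_iff)
  moreover have ?case if "r = b"
    using n that by (intro exI[of _ "Suc n"] exI[of _ b] exI[of _ a]) (simp add: insert_commute)
  moreover have ?case if "r = a"
  proof (cases n)
    case 0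
    then show ?thesis
      using n that by (intro exI[of _ 1] exI[of _ a] exI[of _ b]) simp
  next
    case (Suc k)
    have "act (r # x) = reflect r \<circ> act (alternating n a b)"
      using n(3) by simp
    also have "\<dots> = act (alternating k b a)"
      using Suc that Cons.prems by (auto simp: reflect_reflect)
    finally show ?thesis
      using n Suc by (intro exI[of _ k] exI[of _ b] exI[of _ a]) (simp add: insert_commute)
  qed
  ultimately show ?case by blast
qed

text \<open>
  Deodhar's theorem. Write \<open>w = v x\<close> with \<open>len w = len v + length x\<close>, where \<open>x\<close> is a word in \<open>s\<close>
  and the last letter \<open>t\<close> of \<open>w\<close>, and with \<open>v\<close> as short as possible. Then \<open>v\<close> maps both simple
  roots to nonnegative vectors by induction, and \<open>x\<close> maps the first one to a nonnegative combination
  of the two, since \<open>x s\<close> is no shorter than \<open>x\<close>.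
\<close>

lemma act_simple_root_nonneg:
  assumes "set w \<subseteq> V" "s \<in> V" "len (act w) \<le> len (act (w @ [s]))"
  shows "0 \<le> act w (simple_root s) r"
  using assms
proof (induction "len (act w)" arbitrary: w s r rule: less_induct)
  case less
  obtain u where u: "set u \<subseteq> V" "act u = act w" "length u = len (act w)"
    using len_attained less.prems(1) by blast
  show ?case
  proof (cases u rule: rev_cases)
    case Nil
    then show ?thesis using u(2) by (simp add: fun_eq_iff simple_root_def flip: u(2))
  next
    case (snoc u' t)
    have tV: "t \<in> V" using u(1) snoc by simp
    have ts: "t \<noteq> s"
    proof
      assume "t = s"
      then have "act (w @ [s]) = act (u' @ [t, t])"
        using act_append_cong[OF u(2)[symmetric] HOL.refl, of "[s]"] snoc by simp
      then have "act (w @ [s]) = act u'"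
        using act_append_self[OF tV] by simp
      then show False
        using len_le[of u'] u snoc less.prems(3) by simp
    qed
    define D where "D v x \<longleftrightarrow> set v \<subseteq> V \<and> set x \<subseteq> {s, t} \<and> act (v @ x) = act w \<and>
      length v + length x = len (act w)" for v x
    have "D u' [t]"
      using u snoc by (simp add: D_def)
    then obtain v where v: "\<exists>x. D v x" "\<And>v'. \<exists>x. D v' x \<Longrightarrow> length v \<le> length v'"
      using ex_has_least_nat[of "\<lambda>v. \<exists>x. D v x" u' length] by blast
    then obtain x where x: "D v x" by blast
    have short: "len (act w) \<le> length v' + length x'"
      if "set v' \<subseteq> V" "set x' \<subseteq> {s, t}" "act (v' @ x') = act w" for v' x'
      using len_le[of "v' @ x'"] that tV less.prems(2) by (auto simp del: foldr_append)
    have len_v: "len (act v) = length v"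
    proof -
      obtain v' where v': "set v' \<subseteq> V" "act v' = act v" "length v' = len (act v)"
        using len_attained[of v] x by (auto simp: D_def)
      have "len (act w) \<le> length v' + length x"
        using x v' act_append_cong[OF v'(2) HOL.refl, of x] by (intro short) (auto simp: D_def)
      then show ?thesis using len_le[of v] v' x by (simp add: D_def)
    qed
    have "length v \<le> length u'" using v \<open>D u' [t]\<close> by blast
    then have less_v: "len (act v) < len (act w)" using len_v u(3) snoc by simp
    \<comment> \<open>Otherwise \<open>q\<close> could be moved from \<open>v\<close> to the front
      of \<open>x\<close>, which contradicts the minimal length of \<open>v\<close>.\<close>
    have "len (act v) \<le> len (act (v @ [q]))" if q: "q \<in> {s, t}" for q
    proof (rule ccontr)
      assume less_q: "\<not> ?thesis"
      have qV: "q \<in> V" using q tV less.prems by auto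
      obtain v' where v': "set v' \<subseteq> V" "act v' = act (v @ [q])" "length v' = len (act (v @ [q]))"
        using len_attained[of "v @ [q]"] x qV by (auto simp: D_def)
      have "act (v' @ q # x) = act (v @ [q] @ q # x)"
        using act_append_cong[OF v'(2) HOL.refl, of "q # x"] by simp
      also have "\<dots> = act w"
        using act_append_cong[OF act_append_self[OF qV] HOL.refl, of v x] x by (simp add: D_def)
      finally have eq: "act (v' @ q # x) = act w" .
      have "len (act w) \<le> length v' + length (q # x)"
        using v' q x eq by (intro short) (auto simp: D_def)
      then have "D v' (q # x)"
        using v' q x eq less_q len_v by (auto simp: D_def)
      then show False using v(2) v' less_q len_v by fastforce
    qed
    then have nonneg: "0 \<le> act v (simple_root q) r" if "q \<in> {s, t}" for q r
      using that less_v x tV less.prems(2) by (intro less.hyps) (auto simp: D_def)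
    obtain n a b where n: "{a, b} = {s, t}" "n \<le> length x" "act (alternating n a b) = act x"
      using act_eq_alternating[of x s t] x tV less.prems(2) by (auto simp: D_def)
    have abV: "a \<in> V" "b \<in> V" using n(1) tV less.prems(2) by auto
    \<comment> \<open>Since \<open>s\<close> does not shorten \<open>w\<close>, no word in
      \<open>s\<close> and \<open>t\<close> that represents x s is shorter than
      \<open>x\<close>.\<close>
    have minimal: "length x \<le> length x'" if "set x' \<subseteq> {s, t}" "act x' = act (x @ [s])" for x'
    proof -
      have "act (v @ x') = act ((v @ x) @ [s])"
        using act_append_cong[OF HOL.refl that(2), of v] by simp
      also have "\<dots> = act (w @ [s])"
        using x by (intro act_append_cong) (auto simp: D_def)
      finally have "len (act (w @ [s])) \<le> length (v @ x')"
        using len_le[of "v @ x'"] that x tV less.prems(2) by (auto simp: D_def simp del: foldr_append)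
      then show ?thesis using less.prems(3) x by (auto simp: D_def)
    qed
    have "act x (simple_root s) = comb (dihedral_coeff (- cartan a b) (Suc n)) (simple_root a)
         (dihedral_coeff (- cartan a b) n) (simple_root b)
       \<and> ({a, b} \<in> edges \<Gamma> \<longrightarrow> Suc n \<le> label \<Gamma> {a, b})" if "n \<noteq> 0"
    proof -
      obtain k where k: "n = Suc k" using \<open>n \<noteq> 0\<close> by (cases n) auto
      \<comment> \<open>An alternating word ending in \<open>s\<close> would let x s cancel to k
        letters. So its last letter is \<open>t\<close>, and \<open>s\<close> is the letter that
        prolongs it, as \<open>act_alternating\<close> requires.\<close>
      have "(if even k then a else b) \<noteq> s"
      proof
        assume "(if even k then a else b) = s"
        then have "act (x @ [s]) = act (alternating k a b @ [s, s])"
          using act_append_cong[OF n(3)[symmetric] HOL.refl, of "[s]"] k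
          by (simp add: alternating_Suc_right del: alternating.simps)
        also have "\<dots> = act (alternating k a b)"
          using less.prems(2) by (rule act_append_self)
        finally show False
          using minimal[of "alternating k a b"] set_alternating[of k a b] n k by auto
      qed
      then have s: "(if even n then a else b) = s" and t: "(if even k then a else b) = t"
        using n(1) k ts by (auto simp: doubleton_eq_iff split: if_splits)
      \<comment> \<open>If n reached the label, the last m letters would be one side of a braid
        relation. The other side ends in \<open>s\<close>, which cancels against the appended
        \<open>s\<close>, contrary to \<open>minimal\<close>.\<close>
      have "Suc n \<le> label \<Gamma> {a, b}" if e: "{a, b} \<in> edges \<Gamma>"
      proof (rule ccontr)
        assume "\<not> ?thesis"
        then have le: "label \<Gamma> {a, b} \<le> n" by simp
        define m where "m = label \<Gamma> {a, b}"
        obtain i where i: "m = Suc i" using edgeD(4)[OF e] by (cases m) (auto simp: m_def)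
        obtain c d where cd: "{c, d} = {a, b}" "alternating n a b = alternating (n - m) a b @ alternating m c d"
          using alternating_add[of "n - m" m a b] le
          by (cases "even (n - m)") (auto simp: m_def insert_commute)
        have "(if even k then a else b) = (if even i then c else d)"
          using cd(2) unfolding k i
          by (simp add: alternating_Suc_right del: alternating.simps split del: if_split)
        then have "(if even i then d else c) = s"
          using t cd(1) n(1) ts by (auto simp: doubleton_eq_iff split: if_splits)
        then have "act (x @ [s]) = act ((alternating (n - m) a b @ alternating i d c) @ [s, s])"
        proof -
          have "act (x @ [s]) = act (alternating n a b @ [s])"
            using n(3) by (intro act_append_cong) simp_all
          also have "\<dots> = act (alternating (n - m) a b @ alternating m c d @ [s])"
            by (simp add: cd(2) del: foldr_append)
          also have "\<dots> = act (alternating (n - m) a b @ alternating m d c @ [s])"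
            using act_braid[of c d] cd(1) e by (intro act_append_cong) (simp_all add: m_def)
          also have "\<dots> = act ((alternating (n - m) a b @ alternating i d c) @ [s, s])"
            using \<open>(if even i then d else c) = s\<close> unfolding i alternating_Suc_right by simp
          finally show ?thesis .
        qed
        also have "\<dots> = act (alternating (n - m) a b @ alternating i d c)"
          using less.prems(2) by (rule act_append_self)
        finally have "act (alternating (n - m) a b @ alternating i d c) = act (x @ [s])" ..
        moreover have "set (alternating (n - m) a b @ alternating i d c) \<subseteq> {s, t}"
          using set_alternating[of "n - m" a b] set_alternating[of i d c] cd(1) n(1) by auto
        ultimately have "length x \<le> n - m + i"
          using minimal by fastforce
        then show False
          using n(2) i le by (simp add: m_def)
      qed
      then show ?thesis
        using act_alternating[OF abV, of n] s n(3) by auto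
    qed
    then have "\<exists>p q. 0 \<le> p \<and> 0 \<le> q \<and> act x (simple_root s) = comb p (simple_root s) q (simple_root t)"
    proof (cases "n = 0")
      case True
      then have "act x (simple_root s) = comb 1 (simple_root s) 0 (simple_root t)"
        by (simp add: comb_def flip: n(3))
      then show ?thesis by (intro exI[of _ 1] exI[of _ 0]) simp
    next
      case False
      then have *: "act x (simple_root s) = comb (dihedral_coeff (- cartan a b) (Suc n)) (simple_root a)
         (dihedral_coeff (- cartan a b) n) (simple_root b)"
        "{a, b} \<in> edges \<Gamma> \<Longrightarrow> Suc n \<le> label \<Gamma> {a, b}"
        using \<open>n \<noteq> 0 \<Longrightarrow> _\<close> by auto
      have "a \<noteq> b" using n(1) ts by auto
      then have ge: "0 \<le> dihedral_coeff (- cartan a b) (Suc n)" "0 \<le> dihedral_coeff (- cartan a b) n"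
        using *(2) by (auto intro!: dihedral_coeff_nonneg)
      have "a = s \<and> b = t \<or> a = t \<and> b = s" using n(1) by (auto simp: doubleton_eq_iff)
      moreover have "comb p u q v = comb q v p u" for p q u v by (auto simp: comb_def)
      ultimately show ?thesis using ge *(1) by metis
    qed
    then obtain p q where "0 \<le> p" "0 \<le> q" "act x (simple_root s) = comb p (simple_root s) q (simple_root t)"
      by blast
    moreover have "act w (simple_root s) = act (v @ x) (simple_root s)"
      using x by (simp add: D_def del: foldr_append)
    ultimately show ?thesis using nonneg by (simp add: act_comb) (simp add: comb_def)
  qed
qed

text \<open>One of w and w s is no longer than the other, so Deodhar's theorem applies to it; the
  two send the root of \<open>s\<close> to opposite vectors.\<close>

lemma root_sign:
  assumes "set w \<subseteq> V" "s \<in> V"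
  shows "(\<forall>r. 0 \<le> act w (simple_root s) r) \<or> (\<forall>r. act w (simple_root s) r \<le> 0)"
proof (cases "len (act w) \<le> len (act (w @ [s]))")
  case True
  then show ?thesis using assms act_simple_root_nonneg by blast
next
  case False
  have "act ((w @ [s]) @ [s]) = act w"
    using act_append_self[OF assms(2), of w] by simp
  then have "0 \<le> act (w @ [s]) (simple_root s) r" for r
    using assms False by (intro act_simple_root_nonneg) auto
  then show ?thesis
    using assms by (simp add: reflect_simple_root_self act_uminus)
qed

lemma act_simple_root_nonzero: "set w \<subseteq> V \<Longrightarrow> act w (simple_root s) \<noteq> (\<lambda>r. 0)"
  using act_inject[of w "simple_root s" "\<lambda>r. 0"] act_scale[of w 0 "simple_root s"]
  by (auto simp: simple_root_def fun_eq_iff split: if_splits)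


section \<open>The retraction onto a special subgroup\<close>

text \<open>
  A word is read from right to left by an automaton whose states are the minimal representatives of
  the cosets of the parabolic subgroup generated by \<open>X\<close> in the Coxeter group (represented by the
  inverses of these representatives). When the reflection in the letter would leave the set of states,
  it is conjugate by the state to some \<open>x \<in> X\<close>, and this \<open>x\<close> is emitted. The emitted word is
  the retraction of Godelle and Paris onto the special subgroup generated by \<open>X\<close>.
\<close>

definition states :: "'v set \<Rightarrow> (('v \<Rightarrow> real) \<Rightarrow> 'v \<Rightarrow> real) set" where
  "states X = {g. (\<exists>w. set w \<subseteq> V \<and> g = act w) \<and> (\<forall>x\<in>X. \<forall>r. 0 \<le> g (simple_root x) r)}"

definition emitter :: "'v set \<Rightarrow> (('v \<Rightarrow> real) \<Rightarrow> 'v \<Rightarrow> real) \<Rightarrow> 'v \<Rightarrow> 'v set" where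
  "emitter X g s = {x \<in> X. g (simple_root x) = simple_root s}"

primrec end_state :: "'v set \<Rightarrow> 'v word \<Rightarrow> (('v \<Rightarrow> real) \<Rightarrow> 'v \<Rightarrow> real) \<Rightarrow> ('v \<Rightarrow> real) \<Rightarrow> 'v \<Rightarrow> real" where
  "end_state X [] g = g"
| "end_state X (l # w) g =
    (let h = end_state X w g in if emitter X h (fst l) = {} then reflect (fst l) \<circ> h else h)"

primrec emitted :: "'v set \<Rightarrow> 'v word \<Rightarrow> (('v \<Rightarrow> real) \<Rightarrow> 'v \<Rightarrow> real) \<Rightarrow> 'v word" where
  "emitted X [] g = []"
| "emitted X (l # w) g =
    (let E = emitter X (end_state X w g) (fst l) in
      if E = {} then emitted X w g else (the_elem E, snd l) # emitted X w g)"

lemma end_state_append: "end_state X (v @ w) g = end_state X v (end_state X w g)"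
  by (induction v) (simp_all add: Let_def)

lemma emitted_append: "emitted X (v @ w) g = emitted X v (end_state X w g) @ emitted X w g"
  by (induction v) (simp_all add: Let_def end_state_append)

lemma id_in_states: "id \<in> states X"
  unfolding states_def by (auto simp: simple_root_def intro!: exI[of _ "[]"])

lemma states_nonneg: "g \<in> states X \<Longrightarrow> x \<in> X \<Longrightarrow> 0 \<le> g (simple_root x) r"
  by (simp add: states_def)

text \<open>States are injective, so an emitter is unique and \<open>the_elem\<close> in
  \<open>emitted\<close> is meaningful.\<close>

lemma emitter_eq:
  assumes "g \<in> states X" "x \<in> X" "g (simple_root x) = simple_root s"
  shows "emitter X g s = {x}"
proof -
  obtain w where "set w \<subseteq> V" "g = act w" using assms(1) by (auto simp: states_def)
  then have "y = x" if "g (simple_root y) = simple_root s" for y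
    using act_inject[of w "simple_root y" "simple_root x"] assms(3) that by simp
  then show ?thesis using assms(2,3) unfolding emitter_def by blast
qed

lemma emitter_cases:
  assumes "g \<in> states X"
  obtains "emitter X g s = {}" | x where "x \<in> X" "g (simple_root x) = simple_root s" "emitter X g s = {x}"
proof (cases "emitter X g s = {}")
  case False
  then obtain x where "x \<in> X" "g (simple_root x) = simple_root s"
    by (auto simp: emitter_def)
  then show ?thesis using that(2) emitter_eq[OF assms] by blast
qed (rule that(1))

text \<open>Reflecting in \<open>s\<close> changes only the coordinate at \<open>s\<close>. If it
  makes the nonnegative root g \<alpha>_x negative, this root is a multiple of \<alpha>_s, hence
  equal to it, and \<open>x\<close> is an emitter.\<close>

lemma reflect_in_states:
  assumes "g \<in> states X" "s \<in> V" "X \<subseteq> V" "emitter X g s = {}"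
  shows "reflect s \<circ> g \<in> states X"
proof -
  obtain w where w: "set w \<subseteq> V" "g = act w" using assms(1) by (auto simp: states_def)
  have "0 \<le> act (s # w) (simple_root x) r" if x: "x \<in> X" for x r
  proof (rule ccontr)
    assume "\<not> ?thesis"
    then have neg: "act (s # w) (simple_root x) q \<le> 0" for q
      using root_sign[of "s # w" x] w x assms(2,3) by fastforce
    have "g (simple_root x) q = 0" if "q \<noteq> s" for q
      using neg[of q] states_nonneg[OF assms(1) x, of q] that w by (simp add: reflect_def simple_root_def)
    then have "g (simple_root x) = (\<lambda>q. g (simple_root x) s * simple_root s q)"
      by (auto simp: simple_root_def)
    then obtain a where a: "g (simple_root x) = (\<lambda>q. a * simple_root s q)" by blast
    moreover have "0 \<le> a"
      using states_nonneg[OF assms(1) x, of s] a by (simp add: simple_root_def)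
    ultimately have "a = 1"
      using act_simple_root_scaled[of w s x a] w x assms(2,3) by auto
    then have "x \<in> emitter X g s"
      using a x by (simp add: emitter_def)
    then show False using assms(4) by simp
  qed
  then show ?thesis
    using w assms(2) by (auto simp: states_def intro!: exI[of _ "s # w"])
qed

lemma end_state_in_states:
  assumes "X \<subseteq> V" "w \<in> words V" "g \<in> states X"
  shows "end_state X w g \<in> states X"
  using assms(2)
proof (induction w)
  case (Cons l w)
  then show ?case using reflect_in_states[of "end_state X w g" X "fst l"] assms(1) by (simp add: Let_def)
qed (simp add: assms)

lemma emitted_in_words:
  assumes "X \<subseteq> V" "w \<in> words V" "g \<in> states X"
  shows "emitted X w g \<in> words X"
  using assms(2)
proof (induction w)
  case (Cons l w)
  then have "end_state X w g \<in> states X" using assms by (auto intro: end_state_in_states)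
  then show ?case
    using Cons by (cases rule: emitter_cases[where s = "fst l"]) (simp_all add: Let_def)
qed simp

text \<open>In the Coxeter group, the automaton splits an element into the state reached and an
  element of the parabolic subgroup of \<open>X\<close>. An emission is the conjugation in
  \<open>act_conjugate\<close>.\<close>

lemma act_end_state:
  assumes "X \<subseteq> V" "w \<in> words V" "g \<in> states X"
  shows "act (map fst w) \<circ> g = end_state X w g \<circ> act (map fst (emitted X w g))"
  using assms(2)
proof (induction w)
  case (Cons l w)
  define h where "h = end_state X w g"
  have h: "h \<in> states X" using assms Cons by (auto simp: h_def intro: end_state_in_states)
  have IH: "act (map fst w) \<circ> g = h \<circ> act (map fst (emitted X w g))"
    using Cons.IH Cons.prems unfolding h_def words_Cons by blast
  have Cons_act: "act (map fst (l # w)) \<circ> g = reflect (fst l) \<circ> h \<circ> act (map fst (emitted X w g))"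
    by (simp only: list.map foldr_Cons comp_assoc IH)
  show ?case
  proof (cases rule: emitter_cases[OF h, of "fst l"])
    case 1
    then have "end_state X (l # w) g = reflect (fst l) \<circ> h" "emitted X (l # w) g = emitted X w g"
      by (simp_all add: Let_def flip: h_def)
    then show ?thesis by (simp only: Cons_act)
  next
    case (2 x)
    obtain u where u: "set u \<subseteq> V" "h = act u" using h by (auto simp: states_def)
    have "reflect (fst l) \<circ> h = h \<circ> reflect x"
      using act_conjugate[of u "fst l" x] u 2 assms(1) Cons.prems by (auto intro!: ext)
    moreover have "end_state X (l # w) g = h" "emitted X (l # w) g = (x, snd l) # emitted X w g"
      using 2 by (simp_all add: Let_def flip: h_def)
    ultimately show ?thesis unfolding Cons_act by (simp only: list.map foldr_Cons fst_conv comp_assoc[symmetric])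
  qed
qed simp

section \<open>Compatibility of the automaton with the braid relations\<close>

definition in_plane :: "'v \<Rightarrow> 'v \<Rightarrow> ('v \<Rightarrow> real) \<Rightarrow> bool" where
  "in_plane s t v \<longleftrightarrow> (\<exists>a b. v = comb a (simple_root s) b (simple_root t))"

lemma in_plane_sym: "in_plane s t v \<longleftrightarrow> in_plane t s v"
  unfolding in_plane_def comb_def by (metis add.commute)

lemma in_plane_simple_root: "r \<in> {s, t} \<Longrightarrow> in_plane s t (simple_root r)"
  unfolding in_plane_def
  by (cases "r = s", intro exI[of _ 1] exI[of _ 0], simp add: comb_def,
      intro exI[of _ 0] exI[of _ 1], simp add: comb_def)

lemma in_plane_reflect_imp:
  assumes "in_plane s t v" "r \<in> {s, t}"
  shows "in_plane s t (reflect r v)"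
proof -
  obtain a b where v: "v = comb a (simple_root s) b (simple_root t)"
    using assms(1) by (auto simp: in_plane_def)
  then have "reflect s v = comb (a - pairing v s) (simple_root s) b (simple_root t)"
    "reflect t v = comb a (simple_root s) (b - pairing v t) (simple_root t)"
    by (auto simp: reflect_def comb_def algebra_simps)
  then show ?thesis using assms(2) by (auto simp: in_plane_def)
qed

lemma in_plane_reflect:
  assumes "r \<in> {s, t}" "r \<in> V"
  shows "in_plane s t (reflect r v) \<longleftrightarrow> in_plane s t v"
  using in_plane_reflect_imp[of s t v r] in_plane_reflect_imp[of s t "reflect r v" r] assms
  by (auto simp: reflect_reflect)

lemma in_plane_end_state:
  assumes "w \<in> words {s, t}" "s \<in> V" "t \<in> V"
  shows "in_plane s t (end_state X w g v) \<longleftrightarrow> in_plane s t (g v)"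
  using assms(1) by (induction w) (use assms(2,3) in \<open>auto simp: Let_def in_plane_reflect\<close>)

text \<open>On emission the current state sends \<alpha>_x to a simple root of the plane.
  Reflections in \<open>s\<close> and \<open>t\<close> preserve the plane and its complement, so the
  initial state already sends \<alpha>_x into the plane.\<close>

lemma emitted_in_plane:
  assumes "X \<subseteq> V" "w \<in> words {s, t}" "s \<in> V" "t \<in> V" "g \<in> states X" "l \<in> set (emitted X w g)"
  shows "fst l \<in> X \<and> in_plane s t (g (simple_root (fst l)))"
  using assms(2,6)
proof (induction w)
  case (Cons k w)
  define h where "h = end_state X w g"
  have "w \<in> words V" using Cons.prems assms(3,4) by (auto simp: words_def)
  then have h: "h \<in> states X" using assms by (auto simp: h_def intro: end_state_in_states)
  show ?case
  proof (cases rule: emitter_cases[OF h, of "fst k"])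
    case 1
    then show ?thesis using Cons by (simp flip: h_def)
  next
    case (2 x)
    have "in_plane s t (g (simple_root x))"
      using in_plane_end_state[of w s t X g "simple_root x"] 2 Cons.prems assms(3,4) in_plane_simple_root
      by (auto simp flip: h_def)
    then show ?thesis using Cons 2 by (auto simp flip: h_def)
  qed
qed simp

lemma alternating_word_in_words: "alternating_word n s t \<in> words {s, t}"
  by (induction n arbitrary: s t) (auto simp: words_def)

lemma words_mono: "w \<in> words S \<Longrightarrow> S \<subseteq> S' \<Longrightarrow> w \<in> words S'"
  by (auto simp: words_def)

lemma map_fst_alternating_word [simp]: "map fst (alternating_word n s t) = alternating n s t"
  by (simp add: alternating_word_eq comp_def)

text \<open>Eliminating one coordinate gives a combination of \<alpha>_x and \<alpha>_y that is
  proportional to a root, hence of one sign. So the nonnegative coordinates of the two images have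
  disjoint supports, and equality of norms leaves only the two simple roots.\<close>

lemma two_roots_in_plane:
  assumes "g \<in> states X" "X \<subseteq> V" "x \<in> X" "y \<in> X" "x \<noteq> y" "s \<noteq> t" "s \<in> V" "t \<in> V"
    and "in_plane s t (g (simple_root x))" "in_plane s t (g (simple_root y))"
  shows "g (simple_root x) = simple_root s \<and> g (simple_root y) = simple_root t \<or>
         g (simple_root x) = simple_root t \<and> g (simple_root y) = simple_root s"
proof -
  obtain w where w: "set w \<subseteq> V" "g = act w" using assms(1) by (auto simp: states_def)
  obtain k l where x: "g (simple_root x) = comb k (simple_root s) l (simple_root t)"
    using assms(9) by (auto simp: in_plane_def)
  obtain k' l' where y: "g (simple_root y) = comb k' (simple_root s) l' (simple_root t)"
    using assms(10) by (auto simp: in_plane_def)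
  have ge: "0 \<le> k" "0 \<le> l" "0 \<le> k'" "0 \<le> l'"
    using states_nonneg[OF assms(1,3), of s] states_nonneg[OF assms(1,3), of t]
      states_nonneg[OF assms(1,4), of s] states_nonneg[OF assms(1,4), of t] \<open>s \<noteq> t\<close>
    by (simp_all add: x y comb_def simple_root_def split: if_splits)
  text \<open>\<open>g\<close> maps \<open>p \<alpha>\<^sub>x - q \<alpha>\<^sub>y\<close> to a multiple of a simple root, so \<open>p\<close> and \<open>-q\<close> do not have opposite signs.\<close>
  have sign: "p * q \<le> 0"
    if "comb p (g (simple_root x)) (- q) (g (simple_root y)) = (\<lambda>i. d * simple_root r i)" "r \<in> V" for p q d r
  proof -
    define \<rho> where "\<rho> = act (rev w) (simple_root r)"
    have "act w (comb p (simple_root x) (- q) (simple_root y)) = act w (\<lambda>i. d * \<rho> i)"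
      using that w by (simp add: act_comb act_scale \<rho>_def act_act_rev)
    then have "comb p (simple_root x) (- q) (simple_root y) = (\<lambda>i. d * \<rho> i)"
      using act_inject[OF w(1)] by simp
    from fun_cong[OF this, of x] fun_cong[OF this, of y] have "d * \<rho> x = p" "d * \<rho> y = - q"
      using \<open>x \<noteq> y\<close> by (auto simp: comb_def simple_root_def)
    then have "p * - q = d\<^sup>2 * (\<rho> x * \<rho> y)" by (simp add: power2_eq_square mult_ac flip: minus_mult_right \<open>d * \<rho> x = p\<close> \<open>d * \<rho> y = - q\<close>)
    moreover have "0 \<le> \<rho> x * \<rho> y"
      using root_sign[of "rev w" r] w that(2) by (auto simp: \<rho>_def mult_nonpos_nonpos)
    ultimately have "0 \<le> p * - q" by simp
    then show ?thesis by simp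
  qed
  have "l' * l \<le> 0"
    by (rule sign[where d = "k * l' - k' * l" and r = s])
      (use assms in \<open>auto simp: x y comb_def algebra_simps\<close>)
  moreover have "k' * k \<le> 0"
    by (rule sign[where d = "l * k' - l' * k" and r = t])
      (use assms in \<open>auto simp: x y comb_def algebra_simps\<close>)
  ultimately have zero: "l' = 0 \<or> l = 0" "k' = 0 \<or> k = 0"
    using ge by (metis antisym mult_nonneg_nonneg mult_eq_0_iff)+
  have "g (simple_root z) \<noteq> (\<lambda>r. 0)" for z
    using act_simple_root_nonzero w by simp
  from this[of x] this[of y] have nonzero: "k \<noteq> 0 \<or> l \<noteq> 0" "k' \<noteq> 0 \<or> l' \<noteq> 0"
    by (auto simp: x y comb_def)
  have scaled: "a = 1" if "g (simple_root z) = (\<lambda>i. a * simple_root r i)" "z \<in> X" "r \<in> V" "0 \<le> a" for a z r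
    using act_simple_root_scaled[of w r z a] that w assms(2) by auto
  show ?thesis
  proof (cases "l = 0")
    case True
    then have "k = 1" "l' = 1" "k' = 0"
      using zero nonzero ge assms x y scaled[of x k s] scaled[of y l' t] by (auto simp: comb_def)
    then show ?thesis using True x y by (auto simp: comb_def)
  next
    case False
    then have "l = 1" "k' = 1" "l' = 0" "k = 0"
      using zero nonzero ge assms x y scaled[of x l t] scaled[of y k' s] by (auto simp: comb_def)
    then show ?thesis using x y by (auto simp: comb_def)
  qed
qed

text \<open>Invariance of the form equates the Cartan entries. An entry above -2 forces an edge, and
  cosine is injective on [0, pi].\<close>

lemma two_roots_label:
  assumes "g \<in> states X" "X \<subseteq> V" "x \<in> X" "y \<in> X" "{s, t} \<in> edges \<Gamma>"
    and "g (simple_root x) = simple_root s" "g (simple_root y) = simple_root t"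
  shows "{x, y} \<in> edges \<Gamma> \<and> label \<Gamma> {x, y} = label \<Gamma> {s, t}"
proof -
  note e = edgeD[OF assms(5)]
  obtain w where w: "set w \<subseteq> V" "g = act w" using assms(1) by (auto simp: states_def)
  have "x \<noteq> y" using assms(6,7) e(3) by auto
  have "form (act w (simple_root x)) (act w (simple_root y)) = form (simple_root x) (simple_root y)"
    using w(1) by (rule form_act)
  moreover have "form (simple_root p) (simple_root q) = cartan p q" if "p \<in> V" "q \<in> V" for p q
    using that by (simp add: form_simple_root pairing_simple_root cartan_sym)
  ultimately have cartan: "cartan s t = cartan x y"
    using w(2) assms e by (auto simp: subset_iff)
  then have xy: "{x, y} \<in> edges \<Gamma>"
    using cartan_edge_greater[OF assms(5)] \<open>x \<noteq> y\<close> by (auto simp: cartan_def split: if_splits)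
  then have "cos (pi / label \<Gamma> {x, y}) = cos (pi / label \<Gamma> {s, t})"
    using cartan \<open>x \<noteq> y\<close> assms(5) e(3) by (simp add: cartan_def)
  moreover have "0 \<le> pi / real n" "pi / real n \<le> pi" if "2 \<le> n" for n
    using that divide_left_mono[of 1 "real n" pi] by simp_all
  ultimately have "pi / label \<Gamma> {x, y} = pi / label \<Gamma> {s, t}"
    using edgeD(4)[OF xy] e(4) cos_inj_pi by blast
  then have "real (label \<Gamma> {x, y}) = real (label \<Gamma> {s, t})"
    using edgeD(4)[OF xy] e(4) by (simp add: frac_eq_eq)
  then show ?thesis using xy by simp
qed

text \<open>Both simple roots of the plane come from \<open>X\<close>, so every letter is emitted
  under its new name and the state never moves.\<close>

lemma emitted_alternating_fixed:
  assumes "g \<in> states X" "x \<in> X" "y \<in> X"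
    and "g (simple_root x) = simple_root s" "g (simple_root y) = simple_root t"
  shows "end_state X (alternating_word n s t) g = g \<and>
         emitted X (alternating_word n s t) g = alternating_word n x y"
  using assms by (induction n arbitrary: s t x y) (simp_all add: Let_def emitter_eq)

text \<open>This is the situation after \<open>x\<close> was emitted by the letter to the right of
  the word. While fewer than m letters are read, the coefficients of the image of \<alpha>_x
  computed in \<open>act_alternating\<close> prevent it from being the simple root of the next
  letter; the strict bound on n is essential, as a coefficient vanishes at m.\<close>

lemma emitted_alternating_Nil:
  assumes "g \<in> states X" "X \<subseteq> V" "{s, t} \<in> edges \<Gamma>" "n < label \<Gamma> {s, t}"
    and "\<And>y. y \<in> X \<Longrightarrow> in_plane s t (g (simple_root y)) \<Longrightarrow> y = x"
    and "g (simple_root x) = simple_root (if even n then s else t)"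
  shows "emitted X (alternating_word n s t) g = [] \<and>
         end_state X (alternating_word n s t) g = act (alternating n s t) \<circ> g"
  using assms(3-)
proof (induction n arbitrary: s t)
  case (Suc n)
  note e = edgeD[OF Suc.prems(1)]
  have x: "g (simple_root x) = simple_root (if even n then t else s)"
    using Suc.prems(4) by simp
  have IH: "emitted X (alternating_word n t s) g = []"
    "end_state X (alternating_word n t s) g = act (alternating n t s) \<circ> g"
    using Suc.IH[of t s] Suc.prems x in_plane_sym[of t s] by (auto simp: insert_commute)
  have "emitter X (act (alternating n t s) \<circ> g) s = {}"
  proof (rule ccontr)
    assume "\<not> ?thesis"
    then obtain y where y: "y \<in> X" "act (alternating n t s) (g (simple_root y)) = simple_root s"
      by (auto simp: emitter_def)
    have "alternating_word n t s \<in> words {s, t}"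
      using alternating_word_in_words[of n t s] by (simp add: insert_commute)
    then have "in_plane s t (g (simple_root y))"
      using in_plane_end_state[of "alternating_word n t s" s t X g "simple_root y"] e IH(2) y
        in_plane_simple_root[of s s t] by simp
    then have "y = x" using Suc.prems(3) y by blast
    then have "comb (dihedral_coeff (- cartan t s) (Suc n)) (simple_root t)
         (dihedral_coeff (- cartan t s) n) (simple_root s) t = simple_root s t"
      using y(2) x act_alternating[OF e(2,1), of n] by simp
    then have "dihedral_coeff (- cartan t s) (Suc n) = 0"
      using e(3) by (simp add: comb_def simple_root_def)
    then show False
      using dihedral_coeff_less_label[of s t "Suc n"] Suc.prems by (simp add: cartan_sym)
  qed
  then show ?case using IH by (simp add: Let_def comp_assoc)
qed simp

lemma alternating_word_Suc_right:
  "alternating_word (Suc n) s t = alternating_word n s t @ [(if even n then s else t, True)]"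
  by (induction n arbitrary: s t) auto

text \<open>The rightmost letter either moves the state, which leaves the hypotheses intact, or
  emits, and then \<open>emitted_alternating_Nil\<close> silences the remaining letters.\<close>

lemma length_emitted_alternating:
  assumes "g \<in> states X" "X \<subseteq> V" "{s, t} \<in> edges \<Gamma>" "n \<le> label \<Gamma> {s, t}"
    and "\<And>x y. x \<in> X \<Longrightarrow> y \<in> X \<Longrightarrow> in_plane s t (g (simple_root x)) \<Longrightarrow>
      in_plane s t (g (simple_root y)) \<Longrightarrow> x = y"
  shows "length (emitted X (alternating_word n s t) g) \<le> 1"
  using assms(1,4,5)
proof (induction n arbitrary: g)
  case (Suc n)
  note e = edgeD[OF assms(3)]
  define z where "z = (if even n then s else t)"
  have z: "z \<in> {s, t}" "z \<in> V" using e by (auto simp: z_def)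
  show ?case
  proof (cases rule: emitter_cases[OF Suc.prems(1), of z])
    case 1
    define h where "h = reflect z \<circ> g"
    have "length (emitted X (alternating_word n s t) h) \<le> 1"
    proof (rule Suc.IH)
      show "h \<in> states X"
        using 1 Suc.prems assms(2) z unfolding h_def by (intro reflect_in_states)
      show "x = y"
        if "x \<in> X" "y \<in> X" "in_plane s t (h (simple_root x))" "in_plane s t (h (simple_root y))" for x y
        using that Suc.prems(3)[of x y] by (simp add: h_def in_plane_reflect[OF z])
    qed (use Suc.prems in simp)
    moreover have "end_state X [(z, True)] g = h" "emitted X [(z, True)] g = []"
      using 1 by (simp_all add: h_def)
    ultimately show ?thesis
      unfolding alternating_word_Suc_right emitted_append by (simp flip: z_def)
  next
    case (2 x)
    have "in_plane s t (g (simple_root x))" using 2 z in_plane_simple_root by simp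
    then have "emitted X (alternating_word n s t) g = []"
      using emitted_alternating_Nil[OF Suc.prems(1) assms(2,3), of n x] Suc.prems 2 by (auto simp: z_def)
    then show ?thesis
      unfolding alternating_word_Suc_right emitted_append using 2 by (simp flip: z_def)
  qed
qed simp

text \<open>If two elements of \<open>X\<close> have images in the plane, the output is a braid
  relation with the same label. Otherwise each side emits at most one letter, and positivity of the
  states forces the same output on both sides.\<close>

lemma emitted_braid:
  assumes "g \<in> states X" "X \<subseteq> V" "{s, t} \<in> edges \<Gamma>"
  defines "m \<equiv> label \<Gamma> {s, t}"
  shows "end_state X (alternating_word m s t) g = end_state X (alternating_word m t s) g \<and>
    (emitted X (alternating_word m s t) g, emitted X (alternating_word m t s) g) \<in> rel"
proof (cases "\<exists>x\<in>X. \<exists>y\<in>X. x \<noteq> y \<and> in_plane s t (g (simple_root x)) \<and> in_plane s t (g (simple_root y))")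
  case True
  note e = edgeD[OF assms(3)]
  obtain x y where xy: "x \<in> X" "y \<in> X" "g (simple_root x) = simple_root s" "g (simple_root y) = simple_root t"
    using True two_roots_in_plane[OF assms(1,2)] e by metis
  have "{x, y} \<in> edges \<Gamma>" "label \<Gamma> {x, y} = m"
    using two_roots_label[OF assms(1,2) xy(1,2) assms(3) xy(3,4)] by (simp_all add: m_def)
  then have "(alternating_word m x y, alternating_word m y x) \<in> artin_relations \<Gamma>"
    by (auto simp: artin_relations_def)
  moreover have "alternating_word m x y \<in> words V" "alternating_word m y x \<in> words V"
    using alternating_word_in_words[of m x y] alternating_word_in_words[of m y x] xy assms(2)
    by (auto elim!: words_mono)
  ultimately have "(alternating_word m x y, alternating_word m y x) \<in> rel"
    using pres_rel.relation[of _ _ "artin_relations \<Gamma>" V "[]" "[]"] by fastforce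
  then show ?thesis
    using emitted_alternating_fixed[OF assms(1) xy] emitted_alternating_fixed[OF assms(1) xy(2,1,4,3)]
    by simp
next
  case False
  \<comment> \<open>Both orders of the two letters are treated at once.\<close>
  define P where "P p q \<longleftrightarrow> {p, q} = {s, t}" for p q
  have P: "P s t" "P t s" by (auto simp: P_def)
  have facts: "length (emitted X (alternating_word m p q) g) \<le> 1"
    "\<And>l. l \<in> set (emitted X (alternating_word m p q) g) \<Longrightarrow> fst l \<in> X \<and> in_plane s t (g (simple_root (fst l)))"
    "end_state X (alternating_word m p q) g \<in> states X"
    "act (alternating m p q) \<circ> g =
       end_state X (alternating_word m p q) g \<circ> act (map fst (emitted X (alternating_word m p q) g))"
    "\<And>l. l \<in> set (emitted X (alternating_word m p q) g) \<Longrightarrow> snd l"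
    if "P p q" for p q
  proof -
    have pq: "{p, q} = {s, t}" using that by (simp add: P_def)
    then have e: "{p, q} \<in> edges \<Gamma>" using assms(3) by simp
    have plane: "in_plane p q v \<longleftrightarrow> in_plane s t v" for v
      using pq in_plane_sym by (auto simp: doubleton_eq_iff)
    have w: "alternating_word m p q \<in> words {s, t}" "alternating_word m p q \<in> words V"
      using alternating_word_in_words[of m p q] pq edgeD[OF e] by (auto elim!: words_mono)
    show "length (emitted X (alternating_word m p q) g) \<le> 1"
      using length_emitted_alternating[OF assms(1,2) e, of m] False pq by (auto simp: m_def plane)
    show "fst l \<in> X \<and> in_plane s t (g (simple_root (fst l)))"
      if "l \<in> set (emitted X (alternating_word m p q) g)" for l
      using emitted_in_plane[OF assms(2) w(1) _ _ assms(1) that] edgeD[OF assms(3)] by blast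
    show "end_state X (alternating_word m p q) g \<in> states X"
      using w assms by (intro end_state_in_states)
    show "act (alternating m p q) \<circ> g =
       end_state X (alternating_word m p q) g \<circ> act (map fst (emitted X (alternating_word m p q) g))"
      using act_end_state[OF assms(2) w(2) assms(1)] by simp
    have "snd ` set (emitted X w g) \<subseteq> snd ` set w" for w
      by (induction w) (auto simp: Let_def)
    moreover have "snd ` set (alternating_word m p q) \<subseteq> {True}"
      by (auto simp: alternating_word_eq)
    ultimately show "snd l" if "l \<in> set (emitted X (alternating_word m p q) g)" for l
      using that by blast
  qed
  have act_eq: "act (alternating m p q) = act (alternating m q p)" if "P p q" for p q
    using act_braid[OF assms(3)] that by (auto simp: P_def m_def doubleton_eq_iff)
  \<comment> \<open>If only one side emitted a letter \<open>x\<close>, the two end states would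
    differ by the reflection in \<open>x\<close> and send \<alpha>_x to opposite nonzero vectors,
    though both are nonnegative.\<close>
  have mixed: "emitted X (alternating_word m q p) g = []"
    if pq: "P p q" "emitted X (alternating_word m p q) g = []" for p q
  proof (rule ccontr)
    assume "\<not> ?thesis"
    have qp: "P q p" using pq by (simp add: P_def insert_commute)
    obtain l where l: "emitted X (alternating_word m q p) g = [l]"
      using facts(1)[OF qp] \<open>emitted X (alternating_word m q p) g \<noteq> []\<close> by (cases "emitted X (alternating_word m q p) g") auto
    then have x: "fst l \<in> X" using facts(2)[OF qp] by simp
    define h where "h = end_state X (alternating_word m q p) g"
    have "end_state X (alternating_word m p q) g = h \<circ> reflect (fst l)"
      using facts(4)[OF pq(1)] facts(4)[OF qp] act_eq[OF pq(1)] pq(2) l by (simp add: h_def)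
    moreover obtain u where u: "h = act u" "set u \<subseteq> V"
      using facts(3)[OF qp] by (auto simp: states_def h_def)
    ultimately have "end_state X (alternating_word m p q) g (simple_root (fst l)) = (\<lambda>r. - h (simple_root (fst l)) r)"
      using x assms(2) by (auto simp: reflect_simple_root_self act_uminus)
    then have "h (simple_root (fst l)) r = 0" for r
      using states_nonneg[OF facts(3)[OF pq(1)] x, of r] states_nonneg[OF facts(3)[OF qp] x, of r]
      by (simp add: h_def)
    then show False using act_simple_root_nonzero[OF u(2)] u(1) by blast
  qed
  have emitted_eq: "emitted X (alternating_word m s t) g = emitted X (alternating_word m t s) g"
  proof (cases "emitted X (alternating_word m s t) g = []")
    case True
    then show ?thesis using mixed P by simp
  next
    case False': False
    then have "emitted X (alternating_word m t s) g \<noteq> []" using mixed P by blast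
    then obtain k l where kl: "emitted X (alternating_word m s t) g = [k]" "emitted X (alternating_word m t s) g = [l]"
      using False' facts(1)[OF P(1)] facts(1)[OF P(2)]
      by (cases "emitted X (alternating_word m s t) g"; cases "emitted X (alternating_word m t s) g") auto
    then have "fst k = fst l" "snd k = snd l"
      using facts(2,5)[OF P(1), of k] facts(2,5)[OF P(2), of l] False by auto
    then show ?thesis using kl by (simp add: prod_eq_iff)
  qed
  define out where "out = emitted X (alternating_word m t s) g"
  have outV: "out \<in> words V"
    unfolding out_def using assms edgeD[OF assms(3)] alternating_word_in_words[of m t s]
    by (intro words_mono[OF emitted_in_words]) (auto elim!: words_mono)
  \<comment> \<open>Both sides act equally and emit the same word, whose action is invertible and
    can be cancelled.\<close>
  have "end_state X (alternating_word m s t) g \<circ> act (map fst out) =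
      end_state X (alternating_word m t s) g \<circ> act (map fst out)"
    using facts(4)[OF P(1)] facts(4)[OF P(2)] act_eq[OF P(1)]
    by (simp only: out_def emitted_eq)
  note eq = fun_cong[OF this, unfolded comp_apply]
  have out_V: "set (map fst out) \<subseteq> V"
    using outV by (auto simp: words_def)
  have "end_state X (alternating_word m s t) g v = end_state X (alternating_word m t s) g v" for v
    using eq[of "act (rev (map fst out)) v"] unfolding act_act_rev[OF out_V] .
  then have "end_state X (alternating_word m s t) g = end_state X (alternating_word m t s) g" ..
  then show ?thesis
    using emitted_eq pres_rel.refl[OF outV] by (simp add: out_def)
qed

text \<open>This makes the retraction well defined on the Artin group. Reading goes from right to
  left, so the replaced subword must also lead to the same state for the prefix to emit the same
  word.\<close>

lemma emitted_cong:
  assumes "(v, w) \<in> rel" "X \<subseteq> V" "g \<in> states X"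
  shows "end_state X v g = end_state X w g \<and> (emitted X v g, emitted X w g) \<in> rel"
proof -
  have outV: "emitted X u g \<in> words V" if "u \<in> words V" "g \<in> states X" for u g
    using emitted_in_words[OF assms(2) that] assms(2) by (rule words_mono)
  show ?thesis
    using assms(1,3)
  proof (induction arbitrary: g rule: pres_rel.induct)
    case (refl w)
    then show ?case using outV by (auto intro: pres_rel.refl)
  next
    case sym
    then show ?case by (metis pres_rel.sym)
  next
    case trans
    then show ?case by (metis pres_rel.trans)
  next
    case (cancel u v s e)
    define h where "h = end_state X v g"
    have h: "h \<in> states X" using assms(2) cancel by (auto simp: h_def intro: end_state_in_states)
    have "end_state X [(s, e), (s, \<not> e)] h = h \<and> (emitted X [(s, e), (s, \<not> e)] h, []) \<in> rel"
    proof (cases rule: emitter_cases[OF h, of s])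
      case 1
      then have rh: "reflect s \<circ> h \<in> states X"
        using h cancel assms(2) by (intro reflect_in_states)
      \<comment> \<open>An emission on the way back would mean that \<open>h\<close> sends
        \<alpha>_x to the negative of \<alpha>_s. Hence the state goes out and returns
        silently.\<close>
      have "emitter X (reflect s \<circ> h) s = {}"
      proof (rule ccontr)
        assume "\<not> ?thesis"
        then obtain x where x: "x \<in> X" "reflect s (h (simple_root x)) = simple_root s"
          by (auto simp: emitter_def)
        then have "h (simple_root x) = (\<lambda>r. - simple_root s r)"
          using cancel reflect_reflect[of s "h (simple_root x)"] by (simp add: reflect_simple_root_self)
        then show False using states_nonneg[OF h x(1), of s] by (simp add: simple_root_def)
      qed
      then show ?thesis
        using 1 cancel by (auto simp: Let_def reflect_reflect intro!: ext pres_rel.refl)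
    next
      case (2 x)
      then show ?thesis
        using pres_rel.cancel[of "[]" V "[]" x e] assms(2) by (auto simp: Let_def)
    qed
    moreover have "(emitted X u h, emitted X u h) \<in> rel" "(emitted X v g, emitted X v g) \<in> rel"
      using outV cancel h by (auto intro: pres_rel.refl)
    ultimately have "end_state X ([(s, e), (s, \<not> e)] @ v) g = h"
      "(emitted X u h @ emitted X [(s, e), (s, \<not> e)] h @ emitted X v g, emitted X u h @ [] @ emitted X v g) \<in> rel"
      by (auto simp only: end_state_append simp flip: h_def intro!: pres_rel_append)
    then show ?case
      by (simp only: end_state_append emitted_append flip: h_def) simp
  next
    case (relation l r u v)
    define h where "h = end_state X v g"
    have h: "h \<in> states X" using assms(2) relation by (auto simp: h_def intro: end_state_in_states)
    have "end_state X l h = end_state X r h \<and> (emitted X l h, emitted X r h) \<in> rel"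
      using relation(1) emitted_braid[OF h assms(2)] by (auto simp: artin_relations_def)
    moreover have "end_state X l h \<in> states X"
      using h assms(2) relation by (auto intro: end_state_in_states)
    moreover have "(emitted X v g, emitted X v g) \<in> rel"
      using outV relation by (auto intro: pres_rel.refl)
    ultimately show ?case
      using relation outV
      by (auto simp: end_state_append emitted_append simp flip: h_def intro!: pres_rel_append pres_rel.refl)
  qed
qed

lemma emitted_self:
  assumes "w \<in> words X" "g \<in> states X" "\<And>x. x \<in> X \<Longrightarrow> g (simple_root x) = simple_root x"
  shows "end_state X w g = g \<and> emitted X w g = w"
  using assms(1)
proof (induction w)
  case (Cons l w)
  then show ?case using emitter_eq[OF assms(2), of "fst l" "fst l"] assms(3) by (simp add: Let_def)
qed simp

text \<open>States reached by letters of \<open>Y\<close> are products of reflections in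
  \<open>Y\<close>, which do not change a coordinate outside \<open>Y\<close>. Hence they send
  \<alpha>_x to a simple root of \<open>Y\<close> only if \<open>x\<close> lies in
  \<open>Y\<close>.\<close>

lemma emitted_in_words_Int:
  assumes "w \<in> words Y" "X \<subseteq> V" "Y \<subseteq> V" "g \<in> states X" "set u \<subseteq> Y" "g = act u"
  shows "(\<exists>u. set u \<subseteq> Y \<and> end_state X w g = act u) \<and> emitted X w g \<in> words (X \<inter> Y)"
  using assms(1)
proof (induction w)
  case Nil
  then show ?case using assms by auto
next
  case (Cons l w)
  define h where "h = end_state X w g"
  obtain u where u: "set u \<subseteq> Y" "h = act u" "fst l \<in> Y" using Cons by (auto simp: h_def)
  have "h \<in> states X"
    using end_state_in_states[OF assms(2) _ assms(4), of w] words_mono[of w Y V] Cons.prems assms(3)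
    by (auto simp: h_def)
  then show ?case
  proof (cases rule: emitter_cases[where s = "fst l"])
    case 1
    then have "end_state X (l # w) g = act (fst l # u)" "emitted X (l # w) g = emitted X w g"
      using u(2) by (simp_all add: Let_def flip: h_def)
    then show ?thesis using Cons u by (intro conjI exI[of _ "fst l # u"]) auto
  next
    case (2 x)
    have "x \<in> Y"
    proof (rule ccontr)
      assume "x \<notin> Y"
      then have "x \<notin> set u" "simple_root (fst l) x = 0" using u by (auto simp: simple_root_def)
      then have "h (simple_root x) x = 1"
        using act_simple_root_outside[of x u] by (simp add: u(2)) (simp add: simple_root_def)
      with \<open>simple_root (fst l) x = 0\<close> show False using 2 by simp
    qed
    then show ?thesis using Cons u 2 by (auto simp flip: h_def)
  qed
qed

text \<open>The retraction onto \<open>X\<close> reproduces \<open>v\<close> and turns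
  \<open>w\<close> into a word over the intersection.\<close>

theorem rel_words_Int:
  assumes "(v, w) \<in> rel" "v \<in> words X" "w \<in> words Y" "X \<subseteq> V" "Y \<subseteq> V"
  shows "\<exists>u\<in>words (X \<inter> Y). (v, u) \<in> rel"
  using emitted_cong[OF assms(1,4) id_in_states] emitted_self[OF assms(2) id_in_states]
    emitted_in_words_Int[OF assms(3-5) id_in_states, of "[]"] by auto

lemma act_cong_rel: "(v, w) \<in> rel \<Longrightarrow> act (map fst v) = act (map fst w)"
proof (induction rule: pres_rel.induct)
  case (cancel u v s e)
  then show ?case by (auto simp: reflect_reflect intro!: ext)
next
  case (relation l r u v)
  then have "act (map fst l) = act (map fst r)"
    using act_braid by (auto simp: artin_relations_def)
  then show ?case by (auto intro!: ext)
qed simp_all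

end


section \<open>Amalgamated products\<close>

definition acts_on :: "('a, 'b) monoid_scheme \<Rightarrow> 'a set \<Rightarrow> 'x set \<Rightarrow> ('a \<Rightarrow> 'x \<Rightarrow> 'x) \<Rightarrow> bool" where
  "acts_on G H \<Omega> \<phi> \<longleftrightarrow>
     (\<forall>h\<in>H. \<forall>x\<in>\<Omega>. \<phi> h x \<in> \<Omega>) \<and> (\<forall>x\<in>\<Omega>. \<phi> \<one>\<^bsub>G\<^esub> x = x) \<and>
     (\<forall>h\<in>H. \<forall>k\<in>H. \<forall>x\<in>\<Omega>. \<phi> (h \<otimes>\<^bsub>G\<^esub> k) x = \<phi> h (\<phi> k x))"

text \<open>
  The universal property of an amalgamated product can only be assumed for actions on sets of one
  type; lists of subsets suffice to let \<open>G\<close> act on the edge paths in the Bass--Serre tree.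
\<close>

locale amalgam = group G for G (structure) +
  fixes S :: "bool \<Rightarrow> 'a set"
  assumes subgroup_S: "subgroup (S b) G"
    and generate_S: "generate G (S True \<union> S False) = carrier G"
    and extension: "\<And>(\<Omega> :: 'a set list set) \<phi>.
      (\<And>b. acts_on G (S b) \<Omega> (\<phi> b)) \<Longrightarrow>
      (\<And>c x. c \<in> S True \<inter> S False \<Longrightarrow> x \<in> \<Omega> \<Longrightarrow> \<phi> True c x = \<phi> False c x) \<Longrightarrow>
      \<exists>\<theta>. acts_on G (carrier G) \<Omega> \<theta> \<and> (\<forall>b. \<forall>h\<in>S b. \<forall>x\<in>\<Omega>. \<theta> h x = \<phi> b h x)"
begin

abbreviation C :: "'a set" where "C \<equiv> S True \<inter> S False"

lemma S_carrier: "h \<in> S b \<Longrightarrow> h \<in> carrier G"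
  using subgroup.subset[OF subgroup_S] by blast

lemma subgroup_C: "subgroup C G"
  by (intro subgroups_Inter_pair subgroup_S)

lemma mem_C: "h \<in> S b \<Longrightarrow> h \<in> S (\<not> b) \<Longrightarrow> h \<in> C"
  by (cases b) auto

section \<open>The Bass-Serre tree as a set of cosets\<close>

text \<open>
  Edges of the tree are the cosets of \<open>C\<close>; the end of type \<open>b\<close> of an edge is the coset of \<open>S b\<close>
  containing it.
\<close>

definition edge :: "'a \<Rightarrow> 'a set" where "edge g = g <# C"

definition tree_edges :: "'a set set" where "tree_edges = edge ` carrier G"

definition vert :: "bool \<Rightarrow> 'a set \<Rightarrow> 'a set" where "vert b x = x <#> S b"

lemma vert_edge: "g \<in> carrier G \<Longrightarrow> vert b (edge g) = g <# S b"
proof -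
  assume g: "g \<in> carrier G"
  have "C <#> S b = S b"
  proof
    show "C <#> S b \<subseteq> S b"
      using subgroup.m_closed[OF subgroup_S[of b]] by (cases b) (auto simp: set_mult_def)
    show "S b \<subseteq> C <#> S b"
    proof
      fix h assume "h \<in> S b"
      then have "h = \<one> \<otimes> h" using S_carrier by simp
      then show "h \<in> C <#> S b"
        using subgroup.one_closed[OF subgroup_C] \<open>h \<in> S b\<close> unfolding set_mult_def by blast
    qed
  qed
  then show ?thesis
    using g set_mult_assoc[of "{g}" C "S b"] S_carrier
    by (auto simp: vert_def edge_def l_coset_eq_set_mult subsetI)
qed

lemma l_coset_eq_iff:
  assumes "subgroup H G" "g \<in> carrier G" "h \<in> carrier G"
  shows "g <# H = h <# H \<longleftrightarrow> inv g \<otimes> h \<in> H"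
proof
  assume "g <# H = h <# H"
  moreover have "h \<otimes> \<one> \<in> h <# H" using subgroup.one_closed[OF assms(1)] by (auto simp: l_coset_def)
  ultimately obtain k where "k \<in> H" "h \<otimes> \<one> = g \<otimes> k" by (auto simp: l_coset_def)
  then show "inv g \<otimes> h \<in> H" using assms subgroup.subset[OF assms(1)] by (auto simp: m_assoc[symmetric])
next
  assume k: "inv g \<otimes> h \<in> H"
  then have "h \<in> g <# H"
    using assms by (auto simp: l_coset_def m_assoc[symmetric] intro!: bexI[of _ "inv g \<otimes> h"])
  then show "g <# H = h <# H"
    using l_repr_independence[of h g H] assms by blast
qed

lemma edge_eq_iff: "g \<in> carrier G \<Longrightarrow> h \<in> carrier G \<Longrightarrow> edge g = edge h \<longleftrightarrow> inv g \<otimes> h \<in> C"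
  unfolding edge_def by (rule l_coset_eq_iff[OF subgroup_C])

lemma vert_edge_eq_iff:
  "g \<in> carrier G \<Longrightarrow> h \<in> carrier G \<Longrightarrow> vert b (edge g) = vert b (edge h) \<longleftrightarrow> inv g \<otimes> h \<in> S b"
  by (simp add: vert_edge l_coset_eq_iff[OF subgroup_S])

text \<open>The tree has no double edges because \<open>C\<close> is the whole intersection of the
  two subgroups.\<close>

lemma edge_eqI:
  assumes "x \<in> tree_edges" "y \<in> tree_edges" "vert b x = vert b y" "vert (\<not> b) x = vert (\<not> b) y"
  shows "x = y"
proof -
  obtain g h where "g \<in> carrier G" "x = edge g" "h \<in> carrier G" "y = edge h"
    using assms(1,2) by (auto simp: tree_edges_def)
  then show ?thesis
    using assms(3,4) mem_C[of "inv g \<otimes> h" b] by (simp add: vert_edge_eq_iff edge_eq_iff)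
qed

lemma edge_in [simp]: "g \<in> carrier G \<Longrightarrow> edge g \<in> tree_edges"
  by (simp add: tree_edges_def)

lemma translate_edge: "g \<in> carrier G \<Longrightarrow> h \<in> carrier G \<Longrightarrow> g <# edge h = edge (g \<otimes> h)"
  unfolding edge_def using S_carrier by (intro lcos_m_assoc) auto

lemma translate_in [simp]: "g \<in> carrier G \<Longrightarrow> x \<in> tree_edges \<Longrightarrow> g <# x \<in> tree_edges"
  by (auto simp: tree_edges_def translate_edge)

lemma inv_mult_translate:
  "g \<in> carrier G \<Longrightarrow> h \<in> carrier G \<Longrightarrow> k \<in> carrier G \<Longrightarrow> inv (g \<otimes> h) \<otimes> (g \<otimes> k) = inv h \<otimes> k"
  by (simp add: inv_mult_group m_assoc) (simp add: m_assoc[symmetric])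

lemma translate_eq_iff:
  "g \<in> carrier G \<Longrightarrow> x \<in> tree_edges \<Longrightarrow> y \<in> tree_edges \<Longrightarrow> g <# x = g <# y \<longleftrightarrow> x = y"
  unfolding tree_edges_def by (elim imageE) (simp add: translate_edge edge_eq_iff inv_mult_translate)

lemma vert_translate_eq_iff:
  "g \<in> carrier G \<Longrightarrow> x \<in> tree_edges \<Longrightarrow> y \<in> tree_edges \<Longrightarrow>
    vert b (g <# x) = vert b (g <# y) \<longleftrightarrow> vert b x = vert b y"
  unfolding tree_edges_def by (elim imageE) (simp add: translate_edge vert_edge_eq_iff inv_mult_translate)

lemma translate_mult: "g \<in> carrier G \<Longrightarrow> h \<in> carrier G \<Longrightarrow> x \<in> tree_edges \<Longrightarrow> (g \<otimes> h) <# x = g <# (h <# x)"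
  by (auto simp: tree_edges_def translate_edge m_assoc)

lemma translate_one: "x \<in> tree_edges \<Longrightarrow> \<one> <# x = x"
  by (auto simp: tree_edges_def translate_edge)

definition base :: "'a set" where "base = edge \<one>"

lemma base_in [simp]: "base \<in> tree_edges"
  by (simp add: base_def)

lemma translate_base: "g \<in> carrier G \<Longrightarrow> g <# base = edge g"
  by (simp add: base_def translate_edge)

lemma edge_eq_base_iff: "g \<in> carrier G \<Longrightarrow> edge g = base \<longleftrightarrow> g \<in> C"
  unfolding base_def using edge_eq_iff[of "\<one>" g] by (auto simp: eq_commute)

lemma vert_edge_eq_base_iff: "g \<in> carrier G \<Longrightarrow> vert b (edge g) = vert b base \<longleftrightarrow> g \<in> S b"
  unfolding base_def using vert_edge_eq_iff[of "\<one>" g] by (auto simp: eq_commute)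

section \<open>Reduced edge paths and the action on them\<close>

text \<open>
  \<open>tree_path b x l\<close>: the edges \<open>x # l\<close> form a path without backtracking which leaves \<open>x\<close> through
  its end of type \<open>b\<close>.
\<close>

primrec tree_path :: "bool \<Rightarrow> 'a set \<Rightarrow> 'a set list \<Rightarrow> bool" where
  "tree_path b x [] \<longleftrightarrow> True"
| "tree_path b x (y # l) \<longleftrightarrow> y \<in> tree_edges \<and> y \<noteq> x \<and> vert b y = vert b x \<and> tree_path (\<not> b) y l"

text \<open>The initial edge \<open>base\<close> is not recorded, so the trivial path is the empty
  list.\<close>

definition paths :: "'a set list set" where "paths = {l. \<exists>b. tree_path b base l}"

text \<open>Reduced paths issuing from the end of type \<open>b\<close> of \<open>base\<close>, with
  all edges recorded. The subgroup \<open>S b\<close> fixes this vertex, so it acts on them by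
  translation.\<close>

definition pointed_paths :: "bool \<Rightarrow> 'a set list set" where
  "pointed_paths b = {x # l | x l. x \<in> tree_edges \<and> vert b x = vert b base \<and> tree_path (\<not> b) x l}"

definition extend :: "bool \<Rightarrow> 'a set list \<Rightarrow> 'a set list" where
  "extend b l = (if l \<noteq> [] \<and> vert b (hd l) = vert b base then l else base # l)"

definition shorten :: "'a set list \<Rightarrow> 'a set list" where
  "shorten l = (if hd l = base then tl l else l)"

definition translate :: "'a \<Rightarrow> 'a set list \<Rightarrow> 'a set list" where
  "translate g = map (\<lambda>x. g <# x)"

text \<open>The translation action of \<open>S b\<close> on \<open>pointed_paths b\<close>,
  transported to \<open>paths\<close> by the mutually inverse maps \<open>extend b\<close> and
  \<open>shorten\<close>.\<close>

definition move :: "bool \<Rightarrow> 'a \<Rightarrow> 'a set list \<Rightarrow> 'a set list" where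
  "move b h l = shorten (translate h (extend b l))"

lemma tree_path_edges: "tree_path b x l \<Longrightarrow> set l \<subseteq> tree_edges"
  by (induction l arbitrary: b x) auto

lemma tree_path_translate:
  "g \<in> carrier G \<Longrightarrow> x \<in> tree_edges \<Longrightarrow> tree_path b x l \<Longrightarrow> tree_path b (g <# x) (translate g l)"
  by (induction l arbitrary: b x) (auto simp: translate_def translate_eq_iff vert_translate_eq_iff)

lemma translate_mult_list:
  "g \<in> carrier G \<Longrightarrow> h \<in> carrier G \<Longrightarrow> set l \<subseteq> tree_edges \<Longrightarrow> translate (g \<otimes> h) l = translate g (translate h l)"
  by (induction l) (auto simp: translate_def translate_mult)

lemma translate_one_list: "set l \<subseteq> tree_edges \<Longrightarrow> translate \<one> l = l"
  by (induction l) (auto simp: translate_def translate_one)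

lemma pointed_paths_edges: "l \<in> pointed_paths b \<Longrightarrow> set l \<subseteq> tree_edges"
  unfolding pointed_paths_def using tree_path_edges by fastforce

lemma vert_hd: "tree_path b base (y # l) \<Longrightarrow> vert b' y = vert b' base \<longleftrightarrow> b' = b"
  using edge_eqI[of y base b] by (cases "b' = b") auto

lemma extend_path: "l \<in> paths \<Longrightarrow> extend b l \<in> pointed_paths b"
proof -
  assume "l \<in> paths"
  then obtain b' where "tree_path b' base l" by (auto simp: paths_def)
  then show ?thesis
    using vert_hd[of b' "hd l" "tl l" b]
    by (cases l; cases "b' = b") (simp_all add: extend_def pointed_paths_def)
qed

lemma shorten_path: "l \<in> pointed_paths b \<Longrightarrow> shorten l \<in> paths"
  by (force simp: pointed_paths_def shorten_def paths_def)

lemma shorten_extend: "l \<in> paths \<Longrightarrow> shorten (extend b l) = l"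
  unfolding paths_def by (cases l) (auto simp: extend_def shorten_def)

lemma extend_shorten: "l \<in> pointed_paths b \<Longrightarrow> extend b (shorten l) = l"
proof -
  assume "l \<in> pointed_paths b"
  then obtain x m where l: "l = x # m" "x \<in> tree_edges" "vert b x = vert b base" "tree_path (\<not> b) x m"
    by (auto simp: pointed_paths_def)
  show ?thesis
  proof (cases "x = base")
    case True
    then show ?thesis using l vert_hd[of "\<not> b" _ _ b] by (cases m) (auto simp: extend_def shorten_def)
  next
    case False
    then show ?thesis using l by (simp add: extend_def shorten_def)
  qed
qed

lemma translate_pointed:
  assumes "h \<in> S b" "l \<in> pointed_paths b"
  shows "translate h l \<in> pointed_paths b"
proof -
  obtain x m where l: "l = x # m" "x \<in> tree_edges" "vert b x = vert b base" "tree_path (\<not> b) x m"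
    using assms(2) by (auto simp: pointed_paths_def)
  have h: "h \<in> carrier G" using assms(1) by (rule S_carrier)
  have "vert b (h <# x) = vert b (h <# base)"
    using l h by (simp add: vert_translate_eq_iff)
  then have "vert b (h <# x) = vert b base"
    using h assms(1) by (simp add: translate_base vert_edge_eq_base_iff)
  then show ?thesis
    using l h tree_path_translate[of h x "\<not> b" m] by (auto simp: pointed_paths_def translate_def)
qed

lemma acts_on_move: "acts_on G (S b) paths (move b)"
  unfolding acts_on_def
proof (intro conjI ballI)
  show "move b h l \<in> paths" if "h \<in> S b" "l \<in> paths" for h l
    using that by (auto simp: move_def intro!: shorten_path[of _ b] translate_pointed extend_path)
  show "move b \<one> l = l" if "l \<in> paths" for l
    using that pointed_paths_edges[OF extend_path[OF that]]
    by (simp add: move_def translate_one_list shorten_extend)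
  show "move b (h \<otimes> k) l = move b h (move b k l)" if "h \<in> S b" "k \<in> S b" "l \<in> paths" for h k l
    using that pointed_paths_edges[OF extend_path[OF that(3), of b]]
    by (simp add: move_def extend_shorten[OF translate_pointed[OF that(2) extend_path[OF that(3)]]]
        translate_mult_list S_carrier)
qed

text \<open>Elements of \<open>C\<close> fix \<open>base\<close>, so adding and removing it has no
  effect. This is the agreement on \<open>C\<close> needed to glue the two actions.\<close>

lemma move_C:
  assumes "c \<in> C" "l \<in> paths"
  shows "move b c l = translate c l"
proof -
  have c: "c \<in> carrier G" "c <# base = base"
    using assms(1) S_carrier[of c True] by (simp_all add: translate_base edge_eq_base_iff)
  obtain b' where b': "tree_path b' base l" using assms(2) by (auto simp: paths_def)
  have "hd (translate c l) \<noteq> base" if "l \<noteq> []"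
    using that b' c translate_eq_iff[OF c(1), of "hd l" base] by (cases l) (auto simp: translate_def)
  then show ?thesis
    using c(2) by (auto simp: move_def extend_def shorten_def) (auto simp: translate_def)
qed

text \<open>Taking the last edge is equivariant; this relates the abstract action on paths to the
  cosets.\<close>

lemma last_move:
  assumes "h \<in> S b" "l \<in> paths"
  shows "last (base # move b h l) = h <# last (base # l)"
proof -
  have shorten: "last (base # shorten m) = last m" if "m \<noteq> []" for m
    using that by (cases m) (auto simp: shorten_def)
  have "extend b l \<noteq> []" "last (extend b l) = last (base # l)"
    by (auto simp: extend_def)
  then show ?thesis
    using shorten[of "translate h (extend b l)"] by (simp add: move_def translate_def last_map)
qed

text \<open>The type \<open>k\<close> of the free end alternates with the length, starting with
  \<open>b\<close> for the empty list.\<close>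

lemma tree_path_snoc:
  assumes "tree_path b x l"
  obtains k where "\<And>y. y \<in> tree_edges \<Longrightarrow> y \<noteq> last (x # l) \<Longrightarrow> vert k y = vert k (last (x # l)) \<Longrightarrow>
    tree_path b x (l @ [y])"
proof -
  have "\<exists>k. \<forall>y\<in>tree_edges. y \<noteq> last (x # l) \<and> vert k y = vert k (last (x # l)) \<longrightarrow> tree_path b x (l @ [y])"
    using assms by (induction l arbitrary: b x) auto
  then show ?thesis using that by blast
qed

theorem center_subset:
  assumes "\<And>b. \<not> S b \<subseteq> C"
  shows "center G \<subseteq> C"
proof
  fix z assume "z \<in> center G"
  then have z: "z \<in> carrier G" "\<And>g. g \<in> carrier G \<Longrightarrow> z \<otimes> g = g \<otimes> z" by (auto simp: center_def)
  obtain \<theta> where \<theta>: "acts_on G (carrier G) paths \<theta>"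
    "\<And>b h l. h \<in> S b \<Longrightarrow> l \<in> paths \<Longrightarrow> \<theta> h l = move b h l"
    using extension[of paths move, OF acts_on_move] by (auto simp: move_C)
  have closed: "\<theta> g l \<in> paths" if "g \<in> carrier G" "l \<in> paths" for g l
    using \<theta>(1) that by (auto simp: acts_on_def)
  have mult: "\<theta> (g \<otimes> h) l = \<theta> g (\<theta> h l)" if "g \<in> carrier G" "h \<in> carrier G" "l \<in> paths" for g h l
    using \<theta>(1) that by (auto simp: acts_on_def)
  have Nil: "[] \<in> paths" by (auto simp: paths_def)
  \<comment> \<open>Equivariance passes from the two subgroups to the group they generate.\<close>
  have last: "last (base # \<theta> g l) = g <# last (base # l)" if "g \<in> carrier G" "l \<in> paths" for g l
  proof -
    have last_in: "last (base # l) \<in> tree_edges" if "l \<in> paths" for l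
      using that tree_path_edges by (fastforce simp: paths_def)
    have "g \<in> generate G (S True \<union> S False)" using that generate_S by simp
    then show ?thesis
      using that(2)
    proof (induction arbitrary: l rule: generate.induct)
      case one
      then show ?case using \<theta>(1) translate_one[OF last_in] by (simp add: acts_on_def del: last.simps)
    next
      case (incl h)
      then show ?case using \<theta>(2) last_move by (auto simp del: last.simps)
    next
      case (inv h)
      then obtain b where "inv h \<in> S b"
        using subgroup.m_inv_closed[OF subgroup_S] by auto
      then show ?case using inv \<theta>(2) last_move by (auto simp del: last.simps)
    next
      case (eng h k)
      then have "h \<in> carrier G" "k \<in> carrier G" using generate_S by auto
      then show ?case
        using eng closed last_in by (simp add: mult translate_mult del: last.simps)
    qed
  qed
  \<comment> \<open>This replaces the absence of cycles: a reduced path from \<open>base\<close> is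
    determined by its last edge. The induction writes the first edge as \<open>edge p\<close> and
    translates the rest back by the inverse of \<open>p\<close>.\<close>
  have unique: "\<theta> g [] = l" if "g \<in> carrier G" "tree_path b base l" "last (base # l) = edge g" for g l b
    using that
  proof (induction "length l" arbitrary: g l b)
    case 0
    then have "edge g = base" by simp
    then have "g \<in> C" using edge_eq_base_iff 0 by blast
    then show ?case using 0 \<theta>(2)[of g True "[]"] Nil by (simp add: move_C translate_def)
  next
    case (Suc n)
    then obtain y l' where l: "l = y # l'" by (cases l) auto
    then obtain p where p: "p \<in> carrier G" "y = edge p" using Suc.prems by (auto simp: tree_edges_def)
    then have pS: "p \<in> S b" "p \<notin> C"
      using Suc.prems l by (auto simp: vert_edge_eq_base_iff edge_eq_base_iff)
    define m where "m = translate (inv p) l'"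
    have base: "inv p <# y = base"
      using p by (simp add: translate_edge base_def)
    have m: "tree_path (\<not> b) base m"
      using tree_path_translate[of "inv p" y "\<not> b" l'] Suc.prems l p base by (simp add: m_def)
    have "last (base # m) = inv p <# last (y # l')"
      using base by (simp add: m_def translate_def last_map)
    then have "last (base # m) = edge (inv p \<otimes> g)"
      using Suc.prems l p by (simp add: translate_edge)
    then have IH: "\<theta> (inv p \<otimes> g) [] = m"
      using Suc.hyps(1)[OF _ _ m] Suc.hyps(2) Suc.prems(1) l p by (simp add: m_def translate_def)
    have "\<theta> g [] = \<theta> (p \<otimes> (inv p \<otimes> g)) []"
      using Suc.prems(1) p by (simp add: m_assoc[symmetric])
    also have "\<dots> = \<theta> p m"
      using mult[OF p(1) _ Nil] IH Suc.prems(1) p by simp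
    also have "\<dots> = move b p m"
      using \<theta>(2)[OF pS(1)] m by (auto simp: paths_def)
    \<comment> \<open>The path \<open>m\<close> leaves through the end of the other type, so
      \<open>base\<close> is put in front; translation by \<open>p\<close> turns it into the first
      edge of \<open>l\<close>.\<close>
    also have "extend b m = base # m"
      using m vert_hd[of "\<not> b" _ _ b] by (cases m) (auto simp: extend_def)
    then have "move b p m = shorten (edge p # translate p m)"
      using p by (simp add: move_def translate_def translate_base)
    also have "translate p m = l'"
      using translate_mult_list[of p "inv p" l'] tree_path_edges[OF Suc.prems(2)] l p
      by (simp add: m_def translate_one_list)
    also have "shorten (edge p # l') = l"
      using l p pS by (simp add: shorten_def edge_eq_base_iff)
    finally show ?case .
  qed
  define l where "l = \<theta> z []"
  have l: "l \<in> paths" "last (base # l) = edge z"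
    using closed[OF z(1) Nil] last[OF z(1) Nil] z by (simp_all add: l_def translate_base)
  show "z \<in> C"
  proof (cases l)
    case Nil
    then have "edge z = base" using l(2) by simp
    then show ?thesis using edge_eq_base_iff z(1) by blast
  next
    case (Cons y l')
    obtain b where b: "tree_path b base l" using l by (auto simp: paths_def)
    obtain k where k: "\<And>y. y \<in> tree_edges \<Longrightarrow> y \<noteq> edge z \<Longrightarrow> vert k y = vert k (edge z) \<Longrightarrow> tree_path b base (l @ [y])"
      using tree_path_snoc[OF b] l(2) by metis
    \<comment> \<open>Any such \<open>h\<close> prolongs \<open>l\<close> by one step, since z h and
      z give distinct edges with the same end of type \<open>k\<close>.\<close>
    obtain h where h: "h \<in> S k" "h \<notin> C" using assms by blast
    have hG: "h \<in> carrier G" using h(1) by (rule S_carrier)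
    have "inv z \<otimes> (z \<otimes> h) = h" using z(1) hG by (simp add: m_assoc[symmetric])
    then have "edge (z \<otimes> h) \<noteq> edge z" "vert k (edge (z \<otimes> h)) = vert k (edge z)"
      using z hG h edge_eq_iff[of z "z \<otimes> h"] vert_edge_eq_iff[of z "z \<otimes> h" k] by (auto simp: eq_commute)
    then have "tree_path b base (l @ [edge (z \<otimes> h)])"
      using k z hG by simp
    \<comment> \<open>By centrality the prolonged path is also the result of applying
      \<open>h\<close> to \<open>l\<close>.\<close>
    then have "l @ [edge (z \<otimes> h)] = \<theta> (z \<otimes> h) []"
      using unique[of "z \<otimes> h" b] z hG by simp
    also have "\<dots> = \<theta> h l"
      using z(2)[OF hG] mult[OF hG z(1) Nil] by (simp add: l_def)
    also have "\<dots> = move k h l"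
      using \<theta>(2)[OF h(1) l(1)] .
    finally have eq: "l @ [edge (z \<otimes> h)] = move k h l" .
    show ?thesis
    proof (cases "k = b")
      case True
      \<comment> \<open>Here applying \<open>h\<close> does not lengthen the path.\<close>
      then have "extend k l = l" using b Cons by (auto simp: extend_def)
      then have "length (move k h l) \<le> length l" by (simp add: move_def shorten_def translate_def)
      then show ?thesis using arg_cong[OF eq, of length] by simp
    next
      case False
      \<comment> \<open>Here the new path begins with \<open>edge h\<close>, which must be the first
        edge of \<open>l\<close>; this puts \<open>h\<close> into both subgroups.\<close>
      then have "extend k l = base # l" using b Cons vert_hd[of b y l' k] by (simp add: extend_def)
      then have "move k h l = edge h # translate h l"
        using h hG by (simp add: move_def translate_def translate_base shorten_def edge_eq_base_iff)
      then have "y = edge h" using eq Cons by simp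
      then have "vert b (edge h) = vert b base" using b Cons by simp
      then have "h \<in> S b" using hG by (simp add: vert_edge_eq_base_iff)
      then show ?thesis using h False mem_C[of h k] by (cases b; cases k) auto
    qed
  qed
qed

end


section \<open>The center of an Artin group\<close>

context artin_graph
begin

abbreviation cls :: "'v word \<Rightarrow> 'v word set" where "cls w \<equiv> rel `` {w}"

lemma carrier_artin_group: "carrier (artin_group \<Gamma>) = cls ` words V"
  by (auto simp: artin_group_def presented_group_def quotient_def)

lemma one_artin_group: "\<one>\<^bsub>artin_group \<Gamma>\<^esub> = cls []"
  by (simp add: artin_group_def presented_group_def)

lemma cls_append: "v \<in> words V \<Longrightarrow> w \<in> words V \<Longrightarrow> cls (v @ w) = cls v \<otimes>\<^bsub>artin_group \<Gamma>\<^esub> cls w"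
  by (simp add: artin_group_def presented_group_mult)

lemma cls_eq_iff: "v \<in> words V \<Longrightarrow> w \<in> words V \<Longrightarrow> cls v = cls w \<longleftrightarrow> (v, w) \<in> rel"
  by (rule eq_equiv_class_iff[OF equiv_pres_rel])

lemma cls_inverse_letter:
  assumes "s \<in> V"
  shows "inv\<^bsub>artin_group \<Gamma>\<^esub> (cls [(s, True)]) = cls [(s, False)]"
proof -
  interpret group "artin_group \<Gamma>" by (rule group_artin_group)
  have "([(s, False), (s, True)], []) \<in> rel"
    using pres_rel.cancel[of "[]" V "[]" s False] assms by simp
  then have "cls [(s, False)] \<otimes>\<^bsub>artin_group \<Gamma>\<^esub> cls [(s, True)] = \<one>\<^bsub>artin_group \<Gamma>\<^esub>"
    using cls_append[of "[(s, False)]" "[(s, True)]"] assms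
      cls_eq_iff[of "[(s, False), (s, True)]" "[]"] by (simp add: one_artin_group)
  then show ?thesis
    using assms by (intro inv_equality) (auto simp: carrier_artin_group)
qed

lemma special_subgroup_eq:
  assumes "K \<subseteq> V"
  shows "special_subgroup \<Gamma> K = cls ` words K"
proof
  interpret group "artin_group \<Gamma>" by (rule group_artin_group)
  have KV: "w \<in> words V" if "w \<in> words K" for w using words_mono[OF that assms] .
  show "special_subgroup \<Gamma> K \<subseteq> cls ` words K"
  proof
    fix g assume "g \<in> special_subgroup \<Gamma> K"
    then show "g \<in> cls ` words K"
      unfolding special_subgroup_def
    proof (induction rule: generate.induct)
      case one
      then show ?case by (auto simp: one_artin_group)
    next
      case (incl h)
      then obtain s where "s \<in> K" "h = cls [(s, True)]" by (auto simp: artin_generator_def)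
      then show ?case by (intro image_eqI[of _ _ "[(s, True)]"]) simp_all
    next
      case (inv h)
      then obtain s where "s \<in> K" "h = cls [(s, True)]" by (auto simp: artin_generator_def)
      then show ?case
        using assms cls_inverse_letter[of s] by (intro image_eqI[of _ _ "[(s, False)]"]) auto
    next
      case (eng g h)
      then obtain v w where "v \<in> words K" "g = cls v" "w \<in> words K" "h = cls w" by blast
      then show ?case using cls_append KV by (intro image_eqI[of _ _ "v @ w"]) simp_all
    qed
  qed
  have "cls w \<in> special_subgroup \<Gamma> K" if "w \<in> words K" for w
    using that
  proof (induction w)
    case Nil
    then show ?case
      using subgroup.one_closed[OF subgroup_special_subgroup[OF assms]] by (simp add: one_artin_group)
  next
    case (Cons l w)
    obtain s e where l: "l = (s, e)" by (cases l)
    then have "artin_generator \<Gamma> s \<in> special_subgroup \<Gamma> K"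
      using Cons.prems unfolding special_subgroup_def by (intro generate.incl) simp
    then have "cls [l] \<in> special_subgroup \<Gamma> K"
      using l Cons.prems assms cls_inverse_letter[of s]
        subgroup.m_inv_closed[OF subgroup_special_subgroup[OF assms], of "cls [(s, True)]"]
      by (cases e) (auto simp: artin_generator_def)
    then show ?case
      using Cons KV[of "[l]"] KV[of w] cls_append[of "[l]" w]
        subgroup.m_closed[OF subgroup_special_subgroup[OF assms], of "cls [l]" "cls w"] by simp
  qed
  then show "cls ` words K \<subseteq> special_subgroup \<Gamma> K" by blast
qed

lemma special_subgroup_Int:
  assumes "X \<subseteq> V" "Y \<subseteq> V"
  shows "special_subgroup \<Gamma> X \<inter> special_subgroup \<Gamma> Y \<subseteq> special_subgroup \<Gamma> (X \<inter> Y)"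
proof
  fix g assume "g \<in> special_subgroup \<Gamma> X \<inter> special_subgroup \<Gamma> Y"
  then obtain v w where vw: "v \<in> words X" "w \<in> words Y" "g = cls v" "g = cls w"
    using assms by (auto simp: special_subgroup_eq)
  then have "(v, w) \<in> rel"
    using cls_eq_iff[of v w] words_mono[of v X V] words_mono[of w Y V] assms by simp
  then obtain u where "u \<in> words (X \<inter> Y)" "(v, u) \<in> rel"
    using rel_words_Int vw assms by blast
  moreover from this have "cls v = cls u"
    using equiv_class_eq[OF equiv_pres_rel] by blast
  ultimately show "g \<in> special_subgroup \<Gamma> (X \<inter> Y)"
    using vw assms by (subst special_subgroup_eq) auto
qed

text \<open>A word without \<open>t\<close> does not change the coordinate at \<open>t\<close>,
  whereas the reflection in \<open>t\<close> negates it on the root of \<open>t\<close>.\<close>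

lemma artin_generator_notin:
  assumes "t \<in> V"
  shows "artin_generator \<Gamma> t \<notin> special_subgroup \<Gamma> (V - {t})"
proof
  assume "artin_generator \<Gamma> t \<in> special_subgroup \<Gamma> (V - {t})"
  then obtain w where w: "w \<in> words (V - {t})" "cls [(t, True)] = cls w"
    by (auto simp: special_subgroup_eq artin_generator_def)
  have "w \<in> words V" using w(1) by (rule words_mono) auto
  then have "act [t] = act (map fst w)"
    using w(2) assms cls_eq_iff[of "[(t, True)]" w] act_cong_rel[of "[(t, True)]" w] by simp
  moreover have "t \<notin> set (map fst w)" using w(1) by (auto simp: words_def)
  then have "act (map fst w) (simple_root t) t = simple_root t t"
    by (rule act_simple_root_outside)
  then have "act (map fst w) (simple_root t) t = 1"
    by (rule HOL.trans) (simp add: simple_root_def)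
  moreover have "act [t] (simple_root t) t = - 1"
    using assms by (simp add: reflect_simple_root_self) (simp add: simple_root_def)
  ultimately show False by simp
qed

text \<open>No braid relation involves both \<open>s\<close> and \<open>t\<close>, so each lies in
  one of the two vertex sets. Two actions that agree on the intersection can therefore be glued
  letter by letter.\<close>

lemma amalgam_artin_group:
  assumes "s \<in> V" "t \<in> V" "s \<noteq> t" "{s, t} \<notin> edges \<Gamma>"
  shows "amalgam (artin_group \<Gamma>) (\<lambda>b. special_subgroup \<Gamma> (V - {if b then s else t}))"
proof -
  define K where "K b = V - {if b then s else t}" for b
  have KV: "K b \<subseteq> V" for b by (auto simp: K_def)
  have words_KV: "w \<in> words V" if "w \<in> words (K b)" for w b
    using words_mono[OF that KV] .
  interpret group "artin_group \<Gamma>" by (rule group_artin_group)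
  let ?S = "\<lambda>b. special_subgroup \<Gamma> (K b)"
  have S: "?S b = cls ` words (K b)" for b
    using KV by (rule special_subgroup_eq)
  have "amalgam (artin_group \<Gamma>) ?S"
  proof (intro amalgam.intro amalgam_axioms.intro group_artin_group)
    show "subgroup (?S b) (artin_group \<Gamma>)" for b
      using KV by (rule subgroup_special_subgroup)
    show "generate (artin_group \<Gamma>) (?S True \<union> ?S False) = carrier (artin_group \<Gamma>)"
    proof
      show "generate (artin_group \<Gamma>) (?S True \<union> ?S False) \<subseteq> carrier (artin_group \<Gamma>)"
        by (intro generate_incl) (auto simp: S carrier_artin_group intro: words_KV)
      have "artin_generator \<Gamma> r \<in> ?S True \<union> ?S False" if "r \<in> V" for r
        using that assms(3) unfolding special_subgroup_def K_def
        by (cases "r = s") (auto intro!: generate.incl)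
      then have "special_subgroup \<Gamma> V \<subseteq> generate (artin_group \<Gamma>) (?S True \<union> ?S False)"
        unfolding special_subgroup_def by (intro mono_generate) blast
      then show "carrier (artin_group \<Gamma>) \<subseteq> generate (artin_group \<Gamma>) (?S True \<union> ?S False)"
        by (simp add: special_subgroup_eq carrier_artin_group)
    qed
    fix \<Omega> :: "'v word set set list set" and \<phi>
    assume \<phi>: "\<And>b. acts_on (artin_group \<Gamma>) (?S b) \<Omega> (\<phi> b)"
      and agree: "\<And>c x. c \<in> ?S True \<inter> ?S False \<Longrightarrow> x \<in> \<Omega> \<Longrightarrow> \<phi> True c x = \<phi> False c x"
    have \<phi>_in: "\<phi> b (cls w) x \<in> \<Omega>" if "w \<in> words (K b)" "x \<in> \<Omega>" for b w x
      using \<phi>[of b] that by (auto simp: acts_on_def S)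
    have \<phi>_append: "\<phi> b (cls (v @ w)) x = \<phi> b (cls v) (\<phi> b (cls w) x)"
      if "v \<in> words (K b)" "w \<in> words (K b)" "x \<in> \<Omega>" for b v w x
      using \<phi>[of b] that cls_append words_KV by (simp add: acts_on_def S)
    have \<phi>_Nil: "\<phi> b (cls []) x = x" if "x \<in> \<Omega>" for b x
      using \<phi>[of b] that by (simp add: acts_on_def one_artin_group)
    \<comment> \<open>The letter \<open>t\<close> acts through \<open>\<phi> True\<close> and every
      other vertex through \<open>\<phi> False\<close>; for letters in both subgroups the choice
      does not matter.\<close>
    define run where "run = foldr (\<lambda>l. \<phi> (fst l = t) (cls [l]))"
    have run_simps: "run [] x = x" "run (l # w) x = \<phi> (fst l = t) (cls [l]) (run w x)"
      "run (v @ w) x = run v (run w x)" for l v w x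
      by (simp_all add: run_def)
    have letter: "[l] \<in> words (K (fst l = t))" if "fst l \<in> V" for l
      using that assms(3) by (auto simp: K_def)
    have run_in: "run w x \<in> \<Omega>" if "w \<in> words V" "x \<in> \<Omega>" for w x
      using that by (induction w) (auto simp: run_simps intro!: \<phi>_in letter)
    have run_eq: "run w x = \<phi> b (cls w) x" if "w \<in> words (K b)" "x \<in> \<Omega>" for w b x
      using that
    proof (induction w)
      case Nil
      then show ?case by (simp add: run_simps \<phi>_Nil)
    next
      case (Cons l w)
      have l: "[l] \<in> words (K b)" using Cons.prems by simp
      have "\<phi> (fst l = t) (cls [l]) y = \<phi> b (cls [l]) y" if "y \<in> \<Omega>" for y
      proof (cases "b = (fst l = t)")
        case False
        then have "[l] \<in> words (K True)" "[l] \<in> words (K False)"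
          using l letter[of l] Cons.prems by (cases b; force simp: K_def)+
        then have "cls [l] \<in> ?S True \<inter> ?S False" by (auto simp: S)
        then show ?thesis using agree that by (cases b; cases "fst l = t") auto
      qed simp
      then show ?case
        using Cons \<phi>_in[of w b x] \<phi>_append[of "[l]" b w x] by (simp add: run_simps)
    qed
    have run_cong_K: "run l x = run r x"
      if "(l, r) \<in> rel" "l \<in> words (K b)" "r \<in> words (K b)" "x \<in> \<Omega>" for l r b x
      using that run_eq cls_eq_iff[of l r] words_KV by simp
    have run_cong: "run v x = run w x" if "(v, w) \<in> rel" "x \<in> \<Omega>" for v w x
      using that
    proof (induction arbitrary: x rule: pres_rel.induct)
      case (cancel u v r e)
      have "([(r, e), (r, \<not> e)], []) \<in> rel"
        using pres_rel.cancel[of "[]" V "[]" r e] cancel by simp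
      then have "run [(r, e), (r, \<not> e)] (run v x) = run [] (run v x)"
        using letter[of "(r, e)"] cancel
        by (intro run_cong_K[of _ _ "r = t"]) (auto intro: run_in)
      then show ?case
        using run_simps(3)[of u "[(r, e), (r, \<not> e)] @ v" x]
          run_simps(3)[of "[(r, e), (r, \<not> e)]" v x] by (simp add: run_simps)
    next
      case (relation l r u v)
      then obtain p q m where e: "{p, q} \<in> edges \<Gamma>" "l = alternating_word m p q" "r = alternating_word m q p"
        by (auto simp: artin_relations_def)
      then have "{p, q} \<noteq> {s, t}" "p \<noteq> q" "p \<in> V" "q \<in> V"
        using assms(4) edgeD[OF e(1)] by auto
      \<comment> \<open>If \<open>s\<close> is not on the edge, V - {s} contains it; otherwise
        \<open>t\<close> is not on it and V - {t} does.\<close>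
      then have "\<exists>b. {p, q} \<subseteq> K b"
        using assms(3) by (intro exI[of _ "s \<notin> {p, q}"]) (auto simp: K_def)
      then obtain b where b: "{p, q} \<subseteq> K b" by blast
      have "(l, r) \<in> rel"
        using pres_rel.relation[of l r _ V "[]" "[]"] relation by simp
      moreover have "l \<in> words (K b)" "r \<in> words (K b)"
        using alternating_word_in_words[of m p q] alternating_word_in_words[of m q p] b e
        by (auto elim!: words_mono)
      ultimately have "run l (run v x) = run r (run v x)"
        using run_cong_K relation run_in by blast
      then show ?case by (simp add: run_simps)
    qed auto
    \<comment> \<open>A chosen representative suffices, since \<open>run\<close> is constant on
      classes by \<open>run_cong\<close>.\<close>
    define \<theta> where "\<theta> A = run (SOME w. w \<in> A)" for A
    have \<theta>: "\<theta> (cls w) x = run w x" if "w \<in> words V" "x \<in> \<Omega>" for w x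
    proof -
      have "w \<in> cls w" using that by (simp add: pres_rel.refl)
      then have "(SOME v. v \<in> cls w) \<in> cls w" by (rule someI)
      then have "(w, SOME v. v \<in> cls w) \<in> rel" by simp
      then show ?thesis unfolding \<theta>_def using run_cong[OF _ that(2)] by simp
    qed
    have "acts_on (artin_group \<Gamma>) (carrier (artin_group \<Gamma>)) \<Omega> \<theta>"
      unfolding acts_on_def carrier_artin_group one_artin_group
    proof (intro conjI ballI, elim imageE)
      show "\<theta> g x \<in> \<Omega>" if "x \<in> \<Omega>" "g = cls w" "w \<in> words V" for g x w
        using that by (simp add: \<theta> run_in)
      show "\<theta> (cls []) x = x" if "x \<in> \<Omega>" for x
        using that by (simp add: \<theta> run_simps)
      show "\<theta> (g \<otimes>\<^bsub>artin_group \<Gamma>\<^esub> h) x = \<theta> g (\<theta> h x)"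
        if "g \<in> cls ` words V" "h \<in> cls ` words V" "x \<in> \<Omega>" for g h x
      proof -
        obtain v w where "v \<in> words V" "g = cls v" "w \<in> words V" "h = cls w" using \<open>g \<in> _\<close> \<open>h \<in> _\<close> by blast
        then show ?thesis
          using \<open>x \<in> \<Omega>\<close> \<theta>[of "v @ w" x] by (simp add: cls_append \<theta> run_in run_simps)
      qed
    qed
    moreover have "\<theta> h x = \<phi> b h x" if "h \<in> ?S b" "x \<in> \<Omega>" for b h x
      using that \<theta> run_eq words_KV by (auto simp: S)
    ultimately show "\<exists>\<theta>. acts_on (artin_group \<Gamma>) (carrier (artin_group \<Gamma>)) \<Omega> \<theta> \<and>
        (\<forall>b. \<forall>h\<in>?S b. \<forall>x\<in>\<Omega>. \<theta> h x = \<phi> b h x)"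
      by blast
  qed
  then show ?thesis by (simp add: K_def)
qed

lemma center_subset_special_subgroup:
  assumes "s \<in> V - cone_points \<Gamma>"
  shows "center (artin_group \<Gamma>) \<subseteq> special_subgroup \<Gamma> (V - {s})"
proof -
  obtain t where t: "t \<in> V" "t \<noteq> s" "{s, t} \<notin> edges \<Gamma>" "s \<in> V"
    using assms by (auto simp: cone_points_def)
  define S where "S = (\<lambda>b. special_subgroup \<Gamma> (V - {if b then s else t}))"
  interpret amalgam "artin_group \<Gamma>" S
    unfolding S_def using t by (intro amalgam_artin_group) auto
  have "\<not> S b \<subseteq> S True \<inter> S False" for b
  proof -
    \<comment> \<open>This vertex belongs to the set generating \<open>S b\<close> and is the one
      omitted from the other set.\<close>
    define r where "r = (if b then t else s)"
    have "artin_generator \<Gamma> r \<in> S b"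
      using t unfolding S_def special_subgroup_def r_def by (auto intro: generate.incl)
    moreover have "artin_generator \<Gamma> r \<notin> S (\<not> b)"
      using artin_generator_notin[of r] t by (auto simp: S_def r_def)
    ultimately show ?thesis by (cases b) auto
  qed
  then have "center (artin_group \<Gamma>) \<subseteq> S True \<inter> S False"
    by (rule center_subset)
  then show ?thesis by (simp add: S_def)
qed

text \<open>The vertices that are not cone points are removed one at a time, each step intersecting
  two special subgroups.\<close>

lemma center_subset_special_subgroup_cone_points:
  "center (artin_group \<Gamma>) \<subseteq> special_subgroup \<Gamma> (cone_points \<Gamma>)"
proof -
  have "center (artin_group \<Gamma>) \<subseteq> special_subgroup \<Gamma> (V - F)"
    if "finite F" "F \<subseteq> V - cone_points \<Gamma>" for F
    using that
  proof (induction F rule: finite_induct)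
    case empty
    show ?case by (auto simp: center_def special_subgroup_eq carrier_artin_group)
  next
    case (insert s F)
    have "center (artin_group \<Gamma>) \<subseteq> special_subgroup \<Gamma> (V - {s}) \<inter> special_subgroup \<Gamma> (V - F)"
      using insert center_subset_special_subgroup[of s] by blast
    also have "\<dots> \<subseteq> special_subgroup \<Gamma> ((V - {s}) \<inter> (V - F))"
      by (intro special_subgroup_Int) auto
    also have "(V - {s}) \<inter> (V - F) = V - insert s F" by blast
    finally show ?case .
  qed
  from this[of "V - cone_points \<Gamma>"] show ?thesis
    by (simp add: double_diff cone_points_def)
qed

end

theorem proposition1p1:
  fixes \<Gamma> :: "'v labelled_graph"
  assumes "defining_graph \<Gamma>"
  shows "center (artin_group \<Gamma>)
           \<subseteq> center ((artin_group \<Gamma>)\<lparr>carrier := special_subgroup \<Gamma> (cone_points \<Gamma>)\<rparr>)"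
proof -
  interpret artin_graph \<Gamma> by unfold_locales (rule assms)
  have "special_subgroup \<Gamma> (cone_points \<Gamma>) \<subseteq> carrier (artin_group \<Gamma>)"
    by (intro subgroup.subset subgroup_special_subgroup) (auto simp: cone_points_def)
  then show ?thesis
    using center_subset_special_subgroup_cone_points by (auto simp: center_def)
qed

end
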